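(* Let $G=\mathbb N_+$ or $G=\{1,\dots,|G|\}$, and let $p(g\mid\mathbf w)=\sum_{k\in\mathcal A}\theta_kP_{(k)}(w_{-k},g)$ be an imitation kernel on $G$. Assume Hypothesis D: there exist $\bar n_0\in\mathbb N_+$ and, for each $i\in G$, a word $\mathbf b_i\in\mathcal A^*$ with $s(\mathbf b_i)=\bar n_0$, such that $\inf_{i\in G}P_{\mathbf b_i}(i,1)=:\varepsilon>0$. Then $\mathcal G(p)$ contains exactly one element.
   Context: $\mathcal A\subset\mathbb N_+$, $\theta$ a probability on $\mathcal A$ with $\theta_k>0$ for $k\in\mathcal A$, each $P_{(k)}$ a stochastic matrix on $G$, $\mathbf w=(w_{-1},w_{-2},\dots)\in G^{-\mathbb N_+}$. Words $\mathcal A^*=\bigcup_{n\ge1}\mathcal A^n$; for $\mathbf a=(a_1,\dots,a_n)$, $P_{\mathbf a}=P_{(a_n)}\cdots P_{(a_1)}$ and depth $s(\mathbf a)=\sum_i a_i$. A law of $(X_n)_{n\in\mathbb Z}$ on $G^{\mathbb Z}$ is compatible with $p$ if $P(X_n=g\mid X_{n-1},X_{n-2},\dots)=p(g\mid X_{n-1},X_{n-2},\dots)$ a.s. for all $n\in\mathbb Z$, $g\in G$; $\mathcal G(p)$ is the set of compatible laws. *)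

theory Defs
  imports "HOL-Probability.Probability"
begin

text \<open>Matrices on the (countable) state space G \<subseteq> nat are functions nat \<Rightarrow> nat \<Rightarrow> real;
  a family of matrices indexed by k is P :: nat \<Rightarrow> nat \<Rightarrow> nat \<Rightarrow> real, P k i j = P_(k)(i,j).\<close>

definition stochastic_on :: "nat set \<Rightarrow> (nat \<Rightarrow> nat \<Rightarrow> real) \<Rightarrow> bool" where
  "stochastic_on G Q \<longleftrightarrow> (\<forall>i\<in>G. (\<forall>j\<in>G. Q i j \<ge> 0) \<and> ((\<lambda>j. Q i j) has_sum 1) G)"

definition matmul :: "nat set \<Rightarrow> (nat \<Rightarrow> nat \<Rightarrow> real) \<Rightarrow> (nat \<Rightarrow> nat \<Rightarrow> real) \<Rightarrow> (nat \<Rightarrow> nat \<Rightarrow> real)" where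
  "matmul G A B = (\<lambda>i j. infsum (\<lambda>l. A i l * B l j) G)"

text \<open>For a word a = [a_1,...,a_n] (n \<ge> 1), P_a = P_(a_n) \<cdots> P_(a_1).\<close>
fun word_mat :: "nat set \<Rightarrow> (nat \<Rightarrow> nat \<Rightarrow> nat \<Rightarrow> real) \<Rightarrow> nat list \<Rightarrow> (nat \<Rightarrow> nat \<Rightarrow> real)" where
  "word_mat G P [] = (\<lambda>i j. if i = j then 1 else 0)"
| "word_mat G P (a # as) = foldl (\<lambda>M b. matmul G (P b) M) (P a) as"

definition depth :: "nat list \<Rightarrow> nat" where
  "depth a = sum_list a"

text \<open>Imitation kernel p(g | w) = \<Sum>_{k\<in>A} theta_k P_(k)(w_{-k}, g), where the past
  w = (w_{-1}, w_{-2}, ...) is encoded as w :: nat \<Rightarrow> nat with w k = w_{-k}.\<close>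
definition imitation_kernel ::
  "nat set \<Rightarrow> (nat \<Rightarrow> real) \<Rightarrow> (nat \<Rightarrow> nat \<Rightarrow> nat \<Rightarrow> real) \<Rightarrow> nat \<Rightarrow> (nat \<Rightarrow> nat) \<Rightarrow> real" where
  "imitation_kernel A \<theta> P g w = infsum (\<lambda>k. \<theta> k * P k (w k) g) A"

definition path_space :: "nat set \<Rightarrow> (int \<Rightarrow> nat) measure" where
  "path_space G = PiM UNIV (\<lambda>_::int. count_space G)"

definition past_algebra :: "nat set \<Rightarrow> int \<Rightarrow> (int \<Rightarrow> nat) measure" where
  "past_algebra G n = sigma (space (path_space G))
      {{x \<in> space (path_space G). x m = g} | m g. m < n \<and> g \<in> G}"

definition compatible ::
  "nat set \<Rightarrow> (nat \<Rightarrow> (nat \<Rightarrow> nat) \<Rightarrow> real) \<Rightarrow> (int \<Rightarrow> nat) measure \<Rightarrow> bool" where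
  "compatible G p M \<longleftrightarrow>
     prob_space M \<and> sets M = sets (path_space G) \<and>
     (\<forall>n::int. \<forall>g\<in>G.
        AE x in M. real_cond_exp M (past_algebra G n) (indicator {y. y n = g}) x
                   = p g (\<lambda>k. x (n - int k)))"

end

theory Submission
  imports Defs
begin

text \<open>
  Running the process backwards, the value at time \<open>u\<close> is inherited along an ancestral line that jumps
  from \<open>u\<close> to \<open>u - k\<close> with probability \<open>\<theta> k\<close>, and the expectation of a product of bounded functions of
  \<open>m\<close> coordinates is computed by \<open>m\<close> such lines, which coalesce when they meet. Two laws that are
  compatible on a long time interval are compared on such products by induction on \<open>m\<close>. If the
  topmost line follows one of the finitely many words of Hypothesis D while all other lines jump by a
  fixed admissible step, then either two lines meet, which leaves only \<open>m - 1\<close> lines, or every word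
  brings the line to the same site \<open>l\<close>. In the second case the average over the words of the
  resulting functions of the state at \<open>l\<close> is a constant plus a function of sup norm at most
  \<open>1 - \<eta>\<close>, and the constant again leaves \<open>m - 1\<close> lines. Hence the discrepancy for \<open>m\<close> lines
  contracts to zero, uniformly in the two laws. This gives uniqueness directly. It also shows that the
  finite-dimensional laws of the processes started from a constant past at time \<open>- N\<close> converge as
  \<open>N\<close> grows, and Kolmogorov's extension theorem then gives existence.
\<close>

section \<open>Products of functions of one coordinate\<close>

text \<open>Coalescence alone cannot give contraction: if every element of \<open>A\<close> is even,
  lines started at sites of different parity never meet. Nor can the topmost line be given the right
  word: the word of Hypothesis D depends on the state at the lower end of the line, which is unknown
  while the line descends. What helps is that positive letters of fixed sum form only finitely many
  words, and that each state is served by at least one of them. The uniform mixture of the words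
  therefore puts mass at least \<open>\<epsilon> / card B\<close> on state 1, whatever the lower
  state is. The difficulty is that different words visit different intermediate sites, while
  averaging makes sense only if the same product of the other coordinates remains for all of them.
  The two laws are never coupled. Only differences of expectations occur, with one bound for all
  pairs of laws and all time windows, so that each block of sites can be treated afresh.\<close>

fun word_pmf :: "(nat \<Rightarrow> nat \<Rightarrow> nat pmf) \<Rightarrow> nat list \<Rightarrow> nat \<Rightarrow> nat pmf" where
  "word_pmf P [] i = return_pmf i"
| "word_pmf P (a # as) i = bind_pmf (word_pmf P as i) (P a)"

text \<open>A coordinate may be inserted repeatedly, so that coalescing lines stay in the class and
  only lower \<^term>\<open>card S\<close>.\<close>

inductive prodf :: "int set \<Rightarrow> ((int \<Rightarrow> nat) \<Rightarrow> real) \<Rightarrow> bool" where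
  one: "prodf {} (\<lambda>_. 1)"
| mult: "prodf S F \<Longrightarrow> (\<And>i. \<bar>h i\<bar> \<le> 1) \<Longrightarrow> prodf (insert s S) (\<lambda>x. F x * h (x s))"

lemma prodf_finite: "prodf S F \<Longrightarrow> finite S"
  by (induction rule: prodf.induct) auto

lemma prodf_bound: "prodf S F \<Longrightarrow> \<bar>F x\<bar> \<le> 1"
  by (induction rule: prodf.induct) (auto simp: abs_mult intro: mult_le_one)

lemma prodf_measurable_compose:
  assumes "prodf S F" "\<And>s. s \<in> S \<Longrightarrow> (\<lambda>x. X x s) \<in> M \<rightarrow>\<^sub>M count_space UNIV"
  shows "(\<lambda>x. F (X x)) \<in> borel_measurable M"
  using assms
proof (induction rule: prodf.induct)
  case (mult S F h s)
  have [measurable]: "(\<lambda>x. X x s) \<in> M \<rightarrow>\<^sub>M count_space UNIV" "(\<lambda>x. F (X x)) \<in> borel_measurable M"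
    using mult by auto
  show ?case by measurable
qed auto

lemma prodf_measurable:
  assumes "prodf S F" "\<And>s. s \<in> S \<Longrightarrow> (\<lambda>x. x s) \<in> M \<rightarrow>\<^sub>M count_space UNIV"
  shows "F \<in> borel_measurable M"
  using assms by (rule prodf_measurable_compose[where X = "\<lambda>x. x"])

text \<open>The chain identity resolves a single factor \<open>h (x u)\<close>, so all factors at
  one site have to be merged first. For \<open>t\<close> outside \<open>S\<close> the constant
  factor 1 serves.\<close>

lemma prodf_extract:
  assumes "prodf S F"
  obtains F' h where "prodf (S - {t}) F'" "\<And>i. \<bar>h i\<bar> \<le> 1" "F = (\<lambda>x. F' x * h (x t))"
proof -
  have "\<exists>F' h. prodf (S - {t}) F' \<and> (\<forall>i. \<bar>h i\<bar> \<le> 1) \<and> F = (\<lambda>x. F' x * h (x t))"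
    using assms
  proof (induction rule: prodf.induct)
    case one
    show ?case
      by (rule exI[of _ "\<lambda>_. 1"], rule exI[of _ "\<lambda>_. 1"]) (auto intro: prodf.one)
  next
    case (mult S F h s)
    then obtain F' h' where F': "prodf (S - {t}) F'" "\<And>i. \<bar>h' i\<bar> \<le> 1"
      "F = (\<lambda>x. F' x * h' (x t))" by blast
    show ?case
    proof (cases "s = t")
      case True
      have "F = (\<lambda>x. F' x * h' (x t))" by fact
      with True F' mult.hyps(2) show ?thesis
        by (intro exI[of _ F'] exI[of _ "\<lambda>i. h' i * h i"])
           (auto simp: abs_mult mult_ac intro: mult_le_one)
    next
      case False
      have "prodf (insert s S - {t}) (\<lambda>x. F' x * h (x s))"
        using prodf.mult[OF F'(1) mult.hyps(2), of s] False by (simp add: insert_Diff_if)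
      with F' show ?thesis
        by (intro exI[of _ "\<lambda>x. F' x * h (x s)"] exI[of _ h']) (auto simp: mult_ac)
    qed
  qed
  then show ?thesis using that by blast
qed

lemma pmf_expectation_bound:
  fixes h :: "'a \<Rightarrow> real"
  assumes "\<And>i. \<bar>h i\<bar> \<le> C"
  shows "\<bar>measure_pmf.expectation p h\<bar> \<le> C"
proof -
  have int: "integrable p h"
    by (rule measure_pmf.integrable_const_bound[of _ C]) (use assms in auto)
  have "\<bar>measure_pmf.expectation p h\<bar> \<le> measure_pmf.expectation p (\<lambda>x. \<bar>h x\<bar>)"
    by (rule integral_abs_bound)
  also have "\<dots> \<le> C"
    by (rule measure_pmf.integral_le_const) (use int assms in auto)
  finally show ?thesis .
qed

lemma pmf_expectation_bind:
  fixes h :: "'b \<Rightarrow> real"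
  assumes "\<And>i. \<bar>h i\<bar> \<le> C"
  shows "measure_pmf.expectation (bind_pmf p f) h
       = measure_pmf.expectation p (\<lambda>x. measure_pmf.expectation (f x) h)"
  unfolding measure_pmf_bind
  by (subst integral_bind[where K = "count_space UNIV" and B = C and B' = 1])
     (auto simp: measure_pmf_in_subprob_algebra assms intro: measure_pmf.emeasure_le_1)

section \<open>Ancestral lines and the discrepancy of two chains\<close>

locale imitation =
  fixes \<theta> :: "nat pmf" and P :: "nat \<Rightarrow> nat \<Rightarrow> nat pmf"
  assumes pos: "0 \<notin> set_pmf \<theta>"
begin

definition lift :: "nat \<Rightarrow> (nat \<Rightarrow> real) \<Rightarrow> nat \<Rightarrow> real" where
  "lift k h = (\<lambda>i. measure_pmf.expectation (P k i) h)"

text \<open>The coordinates in \<open>S\<close> may lie below \<open>s\<close>, and no initial law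
  is prescribed; only the sites in \<open>{s<..t}\<close> have to follow the kernel. Hence processes
  with different pasts fall under one notion and can be compared.\<close>

definition chain :: "(int \<Rightarrow> nat) measure \<Rightarrow> int \<Rightarrow> int \<Rightarrow> bool" where
  "chain M s t \<longleftrightarrow> prob_space M \<and> (\<forall>u. (\<lambda>x. x u) \<in> M \<rightarrow>\<^sub>M count_space UNIV) \<and>
    (\<forall>u F S h. s < u \<longrightarrow> u \<le> t \<longrightarrow> prodf S F \<longrightarrow> S \<subseteq> {..<u} \<longrightarrow> (\<forall>i. \<bar>h i\<bar> \<le> 1) \<longrightarrow>
       (\<integral>x. F x * h (x u) \<partial>M) = (\<integral>k. (\<integral>x. F x * lift k h (x (u - int k)) \<partial>M) \<partial>\<theta>))"

text \<open>The bound is one-sided; swapping the two laws gives the other side.\<close>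

definition near :: "nat \<Rightarrow> int \<Rightarrow> real \<Rightarrow> bool" where
  "near m L D \<longleftrightarrow> (\<forall>M N s t S F. chain M s t \<longrightarrow> chain N s t \<longrightarrow> prodf S F \<longrightarrow> card S \<le> m \<longrightarrow>
     S \<subseteq> {s + L..t} \<longrightarrow> (\<integral>x. F x \<partial>M) - (\<integral>x. F x \<partial>N) \<le> D)"

lemma lift_bound: "(\<And>i. \<bar>h i\<bar> \<le> 1) \<Longrightarrow> \<bar>lift k h i\<bar> \<le> 1"
  unfolding lift_def by (rule pmf_expectation_bound)

lemma prodf_lift: "prodf S F \<Longrightarrow> (\<And>i. \<bar>h i\<bar> \<le> 1) \<Longrightarrow> prodf (insert s S) (\<lambda>x. F x * lift k h (x s))"
  by (rule prodf.mult) (auto intro: lift_bound)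

lemma chain_integrable:
  assumes "chain M s t" "prodf S F"
  shows "integrable M F" "\<bar>\<integral>x. F x \<partial>M\<bar> \<le> 1"
proof -
  interpret prob_space M using assms by (auto simp: chain_def)
  have [measurable]: "F \<in> borel_measurable M"
    by (rule prodf_measurable[OF assms(2)]) (use assms in \<open>auto simp: chain_def\<close>)
  show int: "integrable M F"
    by (rule integrable_const_bound[of _ 1]) (use prodf_bound[OF assms(2)] in auto)
  have "\<bar>\<integral>x. F x \<partial>M\<bar> \<le> (\<integral>x. \<bar>F x\<bar> \<partial>M)" by (rule integral_abs_bound)
  also have "\<dots> \<le> 1"
    by (rule integral_le_const) (use int prodf_bound[OF assms(2)] in auto)
  finally show "\<bar>\<integral>x. F x \<partial>M\<bar> \<le> 1" .
qed

lemma nearD: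
  "near m L D \<Longrightarrow> chain M s t \<Longrightarrow> chain N s t \<Longrightarrow> prodf S F \<Longrightarrow> card S \<le> m \<Longrightarrow> S \<subseteq> {s + L..t}
    \<Longrightarrow> (\<integral>x. F x \<partial>M) - (\<integral>x. F x \<partial>N) \<le> D"
  unfolding near_def by blast

lemma nearI:
  "(\<And>M N s t S F. chain M s t \<Longrightarrow> chain N s t \<Longrightarrow> prodf S F \<Longrightarrow> card S \<le> m \<Longrightarrow> S \<subseteq> {s + L..t}
    \<Longrightarrow> (\<integral>x. F x \<partial>M) - (\<integral>x. F x \<partial>N) \<le> D) \<Longrightarrow> near m L D"
  unfolding near_def by blast

lemma near_mono:
  assumes "near m L D" "L \<le> L'" "D \<le> D'"
  shows "near m L' D'"
proof (rule nearI)
  fix M N s t S F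
  assume "chain M s t" "chain N s t" "prodf S F" "card S \<le> m" and S: "S \<subseteq> {s + L'..t}"
  moreover from S have "S \<subseteq> {s + L..t}" using assms(2) by auto
  ultimately have "(\<integral>x. F x \<partial>M) - (\<integral>x. F x \<partial>N) \<le> D" by (intro nearD[OF assms(1)])
  then show "(\<integral>x. F x \<partial>M) - (\<integral>x. F x \<partial>N) \<le> D'" using assms(3) by linarith
qed

lemma near_2: "near m L 2"
proof (rule nearI)
  fix M N s t S F
  assume "chain M s t" "chain N s t" "prodf S F"
  then show "(\<integral>x. F x \<partial>M) - (\<integral>x. F x \<partial>N) \<le> 2"
    using chain_integrable(2)[of M s t S F] chain_integrable(2)[of N s t S F] by linarith
qed

lemma near_0: "near 0 L 0"
proof (rule nearI)
  fix M N s t S F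
  assume *: "chain M s t" "chain N s t" and "prodf S F" "card S \<le> 0"
  then have "F = (\<lambda>_. 1)"
    using prodf_finite[of S F] by (auto elim: prodf.cases)
  moreover have "prob_space M" "prob_space N" using * by (auto simp: chain_def)
  ultimately show "(\<integral>x. F x \<partial>M) - (\<integral>x. F x \<partial>N) \<le> 0"
    by (simp add: prob_space.prob_space)
qed

text \<open>Both laws are expanded over the jump from \<open>u\<close>. A jump of length at most
  \<open>R\<close> lands at or above \<open>s + L\<close>, where \<open>D\<close> applies; longer
  jumps have discrepancy at most 2 and total mass at most \<open>e\<close>. The chosen jump
  \<open>k\<close> keeps its own discrepancy, and since this is at most \<open>D\<close>, its weight
  may be lowered to \<open>c\<close>.\<close>

lemma step:
  assumes M: "chain M s t" and N: "chain N s t" and F: "prodf S F"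
    and S: "S \<subseteq> {s + L + int R..<u}" and u: "u \<le> t" "s + L + int R \<le> u"
    and L: "0 \<le> L" "1 \<le> R"
    and card: "card S \<le> m" and h: "\<And>i. \<bar>h i\<bar> \<le> 1" and D: "near (Suc m) L D" "0 \<le> D"
    and k: "k \<le> R" and c: "c \<le> pmf \<theta> k"
    and e: "measure \<theta> {R<..} \<le> e"
  shows "(\<integral>x. F x * h (x u) \<partial>M) - (\<integral>x. F x * h (x u) \<partial>N)
    \<le> c * ((\<integral>x. F x * lift k h (x (u - int k)) \<partial>M) - (\<integral>x. F x * lift k h (x (u - int k)) \<partial>N))
      + (1 - c) * D + 2 * e"
proof -
  define d where "d j = (\<integral>x. F x * lift j h (x (u - int j)) \<partial>M) - (\<integral>x. F x * lift j h (x (u - int j)) \<partial>N)" for j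
  have pr: "prodf (insert (u - int j) S) (\<lambda>x. F x * lift j h (x (u - int j)))" for j
    by (rule prodf_lift[OF F h])
  have bM: "\<bar>\<integral>x. F x * lift j h (x (u - int j)) \<partial>M\<bar> \<le> 1" for j
    by (rule chain_integrable(2)[OF M pr])
  have bN: "\<bar>\<integral>x. F x * lift j h (x (u - int j)) \<partial>N\<bar> \<le> 1" for j
    by (rule chain_integrable(2)[OF N pr])
  have dR: "d j \<le> D" if "j \<le> R" for j
    unfolding d_def
  proof (rule nearD[OF D(1) M N pr])
    show "card (insert (u - int j) S) \<le> Suc m"
      using card card_insert_le_m1[of "Suc m" S] prodf_finite[OF F] by (simp add: card_insert_if)
    show "insert (u - int j) S \<subseteq> {s + L..t}" using S u that by auto
  qed
  have d2: "d j \<le> 2" for j using bM[of j] bN[of j] unfolding d_def by linarith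
  have intM: "integrable \<theta> (\<lambda>j. \<integral>x. F x * lift j h (x (u - int j)) \<partial>M)"
    by (rule measure_pmf.integrable_const_bound[of _ 1]) (use bM in auto)
  have intN: "integrable \<theta> (\<lambda>j. \<integral>x. F x * lift j h (x (u - int j)) \<partial>N)"
    by (rule measure_pmf.integrable_const_bound[of _ 1]) (use bN in auto)
  have ind: "integrable \<theta> (indicator X :: nat \<Rightarrow> real)" for X
    by (rule measure_pmf.integrable_const_bound[of _ 1]) auto
  have SS: "S \<subseteq> {..<u}" "s < u" using S u L by auto
  have "(\<integral>x. F x * h (x u) \<partial>M) - (\<integral>x. F x * h (x u) \<partial>N)
     = (\<integral>j. (\<integral>x. F x * lift j h (x (u - int j)) \<partial>M) \<partial>\<theta>) - (\<integral>j. (\<integral>x. F x * lift j h (x (u - int j)) \<partial>N) \<partial>\<theta>)"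
    using M N SS F u h unfolding chain_def by simp
  also have "\<dots> = (\<integral>j. d j \<partial>\<theta>)"
    unfolding d_def using intM intN by simp
  also have "\<dots> \<le> (\<integral>j. D + 2 * indicator {R<..} j - (D - d k) * indicator {k} j \<partial>\<theta>)"
  proof (rule integral_mono)
    show "integrable \<theta> d" unfolding d_def using intM intN by simp
    show "integrable \<theta> (\<lambda>j. D + 2 * indicator {R<..} j - (D - d k) * indicator {k} j)"
      using ind by simp
    show "d j \<le> D + 2 * indicator {R<..} j - (D - d k) * indicator {k} j" for j
      using dR[of j] d2[of j] D(2) k by (auto simp: indicator_def)
  qed
  also have "\<dots> = D + 2 * measure \<theta> {R<..} - (D - d k) * pmf \<theta> k"
    using ind by (simp add: measure_pmf_single)
  also have "\<dots> \<le> D + 2 * e - (D - d k) * c"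
    using e mult_left_mono[OF c, of "D - d k"] dR[OF k] by simp
  finally show ?thesis unfolding d_def by (simp add: algebra_simps)
qed

text \<open>Processes the sites \<open>l + j, \<dots>, l + 1\<close> from the top: the distinguished line follows the word \<open>w\<close>,
  every other line met on the way jumps by \<open>a\<close>. The point is that \<open>S'\<close> and \<open>F'\<close> depend neither on \<open>w\<close> nor
  on \<open>g\<close>; the maximum with \<open>e1\<close> covers the case that the distinguished line meets another one.\<close>

lemma descend:
  assumes M: "chain M s t" and N: "chain N s t"
    and L: "0 \<le> L" "1 \<le> R" and D: "near (Suc m) L D"
    and e1: "near m L e1" "0 \<le> e1" "e1 \<le> D"
    and W: "W \<subseteq> {..R}" "\<And>k. k \<in> W \<Longrightarrow> c \<le> pmf \<theta> k" "0 \<le> c" "c \<le> 1" "0 \<notin> W" "a \<in> W"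
    and e: "measure \<theta> {R<..} \<le> e"
    and F: "prodf S F" "card S \<le> m" "S \<subseteq> {s + L + int R * int j..l + int j}"
    and l: "s + L + int R * int j \<le> l" "l + int j \<le> t"
  shows "\<exists>S' F'. prodf S' F' \<and> card S' \<le> m \<and> S' \<subseteq> {s + L..l} \<and>
     (\<forall>w g. set w \<subseteq> W \<longrightarrow> sum_list w \<le> j \<longrightarrow> (\<forall>i. \<bar>g i\<bar> \<le> 1) \<longrightarrow>
       (\<integral>x. F x * g (x (l + int (sum_list w))) \<partial>M) - (\<integral>x. F x * g (x (l + int (sum_list w))) \<partial>N)
        \<le> c ^ j * max e1 ((\<integral>x. F' x * measure_pmf.expectation (word_pmf P w (x l)) g \<partial>M)
                 - (\<integral>x. F' x * measure_pmf.expectation (word_pmf P w (x l)) g \<partial>N))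
           + (1 - c ^ j) * D + 2 * real j * e)"
  using F l
proof (induction j arbitrary: S F)
  case 0
  have "w = []" if "set w \<subseteq> W" "sum_list w \<le> 0" for w
    using that W(5) by (cases w) auto
  note empty = this
  show ?case
  proof (intro exI conjI allI impI)
    show "prodf S F" "card S \<le> m" "S \<subseteq> {s + L..l}" using 0 by auto
    fix w :: "nat list" and g :: "nat \<Rightarrow> real"
    assume "set w \<subseteq> W" "sum_list w \<le> 0"
    then have "w = []" by (rule empty)
    then show "(\<integral>x. F x * g (x (l + int (sum_list w))) \<partial>M) - (\<integral>x. F x * g (x (l + int (sum_list w))) \<partial>N)
        \<le> c ^ 0 * max e1 ((\<integral>x. F x * measure_pmf.expectation (word_pmf P w (x l)) g \<partial>M)
                 - (\<integral>x. F x * measure_pmf.expectation (word_pmf P w (x l)) g \<partial>N))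
           + (1 - c ^ 0) * D + 2 * real 0 * e" by simp
  qed
next
  case (Suc j)
  define u where "u = l + int (Suc j)"
  have c1: "0 \<le> c ^ j" "c ^ j \<le> 1" "c ^ Suc j \<le> c ^ j" "0 \<le> c ^ Suc j" "c ^ Suc j \<le> 1"
    using W(3,4) by (auto simp: power_le_one mult_left_le_one_le mult_le_one)
  have e0: "0 \<le> e" using e measure_nonneg[of \<theta> "{R<..}"] by linarith
  have D0: "0 \<le> D" using e1 by simp
  have finS: "finite S" using Suc.prems(1) by (rule prodf_finite)
  \<comment> \<open>The margin below \<open>S\<close> shrinks by \<open>R\<close> with each
    processed site; \<open>q\<close> is what the remaining \<open>j\<close> sites need.\<close>
  define q where "q = int R * int j"
  have q: "0 \<le> q" "int R * int (Suc j) = q + int R" by (auto simp: q_def algebra_simps)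
  have Sb: "S \<subseteq> {s + L + q + int R..u}"
    using Suc.prems(3) unfolding q(2) u_def by (simp add: add.assoc)
  have lb: "s + L + q + int R \<le> l" "u \<le> t" "u = l + int j + 1"
    using Suc.prems(4,5) unfolding q(2) u_def by auto
  have l1: "s + L + q \<le> l" "l + int j \<le> t"
    using lb by auto
  have W1: "1 \<le> k" "k \<le> R" if "k \<in> W" for k
    using that W(1,5) by (auto simp: Suc_le_eq intro!: gr0I)
  \<comment> \<open>For a meeting at the topmost site: its bound \<open>e1\<close> fits the claim
    because \<open>max e1 X\<close> and \<open>D\<close> are both at least
    \<open>e1\<close>.\<close>
  have convex: "e1 \<le> q * max e1 X + (1 - q) * D" if "0 \<le> q" "q \<le> 1" for q X :: real
  proof -
    have "q * e1 \<le> q * max e1 X" "(1 - q) * e1 \<le> (1 - q) * D"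
      using that e1(3) by (auto intro: mult_left_mono)
    then show ?thesis by (simp add: algebra_simps)
  qed
  \<comment> \<open>Combines one application of \<open>step\<close> with the induction hypothesis;
    the tail errors simply add up because \<open>c \<le> 1\<close>.\<close>
  have advance: "c * y + (1 - c) * D + 2 * e \<le> c ^ Suc j * X + (1 - c ^ Suc j) * D + 2 * real (Suc j) * e"
    if "y \<le> c ^ j * X + (1 - c ^ j) * D + 2 * real j * e" for y X
  proof -
    have "c * y \<le> c * (c ^ j * X + (1 - c ^ j) * D + 2 * real j * e)"
      using that W(3) by (rule mult_left_mono)
    moreover have "c * (2 * real j * e) \<le> 2 * real j * e"
      using e0 W(3,4) by (intro mult_left_le_one_le) auto
    ultimately show ?thesis by (simp add: algebra_simps)
  qed
  show ?case
  proof (cases "u \<in> S")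
    case True
    obtain F0 h where F0: "prodf (S - {u}) F0" "\<And>i. \<bar>h i\<bar> \<le> 1" "F = (\<lambda>x. F0 x * h (x u))"
      using prodf_extract[OF Suc.prems(1), of u] by blast
    \<comment> \<open>Chosen without reference to the word: the other line at \<open>u\<close> jumps
      by \<open>a\<close>, wherever the distinguished line is below \<open>u\<close>.\<close>
    define S1 F1 where "S1 = insert (u - int a) (S - {u})" and
      "F1 = (\<lambda>x. F0 x * lift a h (x (u - int a)))"
    have F1: "prodf S1 F1" unfolding S1_def F1_def by (rule prodf_lift[OF F0(1,2)])
    have cS: "Suc (card (S - {u})) = card S" using True finS by (rule card_Suc_Diff1[rotated])
    have m1: "card S1 \<le> m"
      using card_insert_le_m1[of m "S - {u}" "u - int a"] cS Suc.prems(2) unfolding S1_def by simp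
    have S1: "S1 \<subseteq> {s + L + q..l + int j}"
      using Sb lb W1[OF W(6)] unfolding S1_def by auto
    obtain S' F' where IH: "prodf S' F'" "card S' \<le> m" "S' \<subseteq> {s + L..l}"
      "\<And>w g. set w \<subseteq> W \<Longrightarrow> sum_list w \<le> j \<Longrightarrow> (\<And>i. \<bar>g i\<bar> \<le> 1) \<Longrightarrow>
       (\<integral>x. F1 x * g (x (l + int (sum_list w))) \<partial>M) - (\<integral>x. F1 x * g (x (l + int (sum_list w))) \<partial>N)
        \<le> c ^ j * max e1 ((\<integral>x. F' x * measure_pmf.expectation (word_pmf P w (x l)) g \<partial>M)
                 - (\<integral>x. F' x * measure_pmf.expectation (word_pmf P w (x l)) g \<partial>N))
           + (1 - c ^ j) * D + 2 * real j * e"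
      using Suc.IH[OF F1 m1, folded q_def, OF S1 l1] by blast
    show ?thesis
    proof (intro exI conjI allI impI)
      fix w and g :: "nat \<Rightarrow> real"
      assume w: "set w \<subseteq> W" "sum_list w \<le> Suc j" and g: "\<forall>i. \<bar>g i\<bar> \<le> 1"
      let ?X = "(\<integral>x. F' x * measure_pmf.expectation (word_pmf P w (x l)) g \<partial>M)
                 - (\<integral>x. F' x * measure_pmf.expectation (word_pmf P w (x l)) g \<partial>N)"
      define p where "p = l + int (sum_list w)"
      show "(\<integral>x. F x * g (x (l + int (sum_list w))) \<partial>M) - (\<integral>x. F x * g (x (l + int (sum_list w))) \<partial>N)
        \<le> c ^ Suc j * max e1 ?X + (1 - c ^ Suc j) * D + 2 * real (Suc j) * e"
      proof (cases "sum_list w = Suc j")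
        \<comment> \<open>The distinguished line stands at \<open>u\<close> as well. It is absorbed
          there, and at most \<open>m\<close> coordinates remain.\<close>
        case eq: True
        have "prodf (insert u S) (\<lambda>x. F x * g (x u))"
          using g by (intro prodf.mult[OF Suc.prems(1)]) auto
        then have "prodf S (\<lambda>x. F x * g (x u))" using True by (simp add: insert_absorb)
        moreover have "S \<subseteq> {s + L..t}" using Sb lb q L by fastforce
        ultimately have "(\<integral>x. F x * g (x u) \<partial>M) - (\<integral>x. F x * g (x u) \<partial>N) \<le> e1"
          using nearD[OF e1(1) M N _ Suc.prems(2)] by blast
        also have "e1 \<le> c ^ Suc j * max e1 ?X + (1 - c ^ Suc j) * D"
          using c1 by (intro convex) auto
        finally have "(\<integral>x. F x * g (x u) \<partial>M) - (\<integral>x. F x * g (x u) \<partial>N)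
          \<le> c ^ Suc j * max e1 ?X + (1 - c ^ Suc j) * D" .
        moreover have "0 \<le> 2 * real (Suc j) * e" using e0 by simp
        ultimately show ?thesis unfolding eq u_def by linarith
      next
        case False
        then have wj: "sum_list w \<le> j" using w by simp
        define F2 where "F2 = (\<lambda>x. F0 x * g (x p))"
        have F2: "prodf (insert p (S - {u})) F2"
          unfolding F2_def using g by (intro prodf.mult[OF F0(1)]) auto
        have "(\<integral>x. F2 x * h (x u) \<partial>M) - (\<integral>x. F2 x * h (x u) \<partial>N)
          \<le> c * ((\<integral>x. F2 x * lift a h (x (u - int a)) \<partial>M) - (\<integral>x. F2 x * lift a h (x (u - int a)) \<partial>N))
            + (1 - c) * D + 2 * e"
        proof (rule step[OF M N F2 _ _ _ L])
          show "insert p (S - {u}) \<subseteq> {s + L + int R..<u}"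
            using Sb lb q wj unfolding p_def by (fastforce simp: order_less_le)
          show "card (insert p (S - {u})) \<le> m"
            using card_insert_le_m1[of m "S - {u}" p] cS Suc.prems(2) by simp
          show "u \<le> t" "s + L + int R \<le> u" using lb q by auto
        qed (use F0(2) D D0 W W1 e in auto)
        also have "F2 = (\<lambda>x. F0 x * g (x p))" by (fact F2_def)
        finally have "(\<integral>x. F x * g (x p) \<partial>M) - (\<integral>x. F x * g (x p) \<partial>N)
          \<le> c * ((\<integral>x. F1 x * g (x p) \<partial>M) - (\<integral>x. F1 x * g (x p) \<partial>N)) + (1 - c) * D + 2 * e"
          unfolding F1_def F0(3) by (simp add: mult_ac)
        also have "\<dots> \<le> c ^ Suc j * max e1 ?X + (1 - c ^ Suc j) * D + 2 * real (Suc j) * e"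
          unfolding p_def using g by (intro advance IH(4)[OF w(1) wj]) auto
        finally show ?thesis unfolding p_def .
      qed
    qed (use IH in auto)
  next
    case False
    have SS: "S \<subseteq> {s + L + q + int R..l + int j}"
    proof
      fix x assume x: "x \<in> S"
      then have "x \<noteq> u" "s + L + q + int R \<le> x" "x \<le> u" using False Sb by auto
      then show "x \<in> {s + L + q + int R..l + int j}" using lb(3) by auto
    qed
    then have S1: "S \<subseteq> {s + L + q..l + int j}" using L by fastforce
    obtain S' F' where IH: "prodf S' F'" "card S' \<le> m" "S' \<subseteq> {s + L..l}"
      "\<And>w g. set w \<subseteq> W \<Longrightarrow> sum_list w \<le> j \<Longrightarrow> (\<And>i. \<bar>g i\<bar> \<le> 1) \<Longrightarrow>
       (\<integral>x. F x * g (x (l + int (sum_list w))) \<partial>M) - (\<integral>x. F x * g (x (l + int (sum_list w))) \<partial>N)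
        \<le> c ^ j * max e1 ((\<integral>x. F' x * measure_pmf.expectation (word_pmf P w (x l)) g \<partial>M)
                 - (\<integral>x. F' x * measure_pmf.expectation (word_pmf P w (x l)) g \<partial>N))
           + (1 - c ^ j) * D + 2 * real j * e"
      using Suc.IH[OF Suc.prems(1,2), folded q_def, OF S1 l1] by blast
    show ?thesis
    proof (intro exI conjI allI impI)
      fix w and g :: "nat \<Rightarrow> real"
      assume w: "set w \<subseteq> W" "sum_list w \<le> Suc j" and g: "\<forall>i. \<bar>g i\<bar> \<le> 1"
      let ?E = "\<lambda>i. measure_pmf.expectation (word_pmf P w i) g"
      let ?X = "(\<integral>x. F' x * ?E (x l) \<partial>M) - (\<integral>x. F' x * ?E (x l) \<partial>N)"
      show "(\<integral>x. F x * g (x (l + int (sum_list w))) \<partial>M) - (\<integral>x. F x * g (x (l + int (sum_list w))) \<partial>N)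
        \<le> c ^ Suc j * max e1 ?X + (1 - c ^ Suc j) * D + 2 * real (Suc j) * e"
      proof (cases "sum_list w = Suc j")
        case True
        \<comment> \<open>The distinguished line stands alone at \<open>u\<close> and follows the
          first letter, which turns \<open>g\<close> into \<open>lift k g\<close> and
          \<open>w\<close> into \<open>w'\<close>. This is why the claim ranges over all
          \<open>g\<close> and over all words of depth at most \<open>j\<close>.\<close>
        then obtain k w' where kw: "w = k # w'" by (cases w) auto
        have k: "k \<in> W" and w': "set w' \<subseteq> W" "sum_list w' \<le> j" and
          p: "u - int k = l + int (sum_list w')"
          using w kw True W1[of k] unfolding u_def by auto
        have "(\<integral>x. F x * g (x u) \<partial>M) - (\<integral>x. F x * g (x u) \<partial>N)
          \<le> c * ((\<integral>x. F x * lift k g (x (u - int k)) \<partial>M) - (\<integral>x. F x * lift k g (x (u - int k)) \<partial>N))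
            + (1 - c) * D + 2 * e"
        proof (rule step[OF M N Suc.prems(1) _ _ _ L])
          show "S \<subseteq> {s + L + int R..<u}"
            using SS lb q by fastforce
          show "u \<le> t" "s + L + int R \<le> u" using lb q by auto
        qed (use g D D0 W W1 k e Suc.prems(2) in auto)
        also have "\<dots> \<le> c ^ Suc j * max e1 ?X + (1 - c ^ Suc j) * D + 2 * real (Suc j) * e"
        proof (rule advance)
          have "measure_pmf.expectation (word_pmf P w' i) (lift k g) = ?E i" for i
            unfolding kw word_pmf.simps lift_def using g by (subst pmf_expectation_bind[of g 1]) auto
          then show "(\<integral>x. F x * lift k g (x (u - int k)) \<partial>M) - (\<integral>x. F x * lift k g (x (u - int k)) \<partial>N)
              \<le> c ^ j * max e1 ?X + (1 - c ^ j) * D + 2 * real j * e"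
            using IH(4)[OF w', of "lift k g"] lift_bound[of g k] g unfolding p by simp
        qed
        finally show ?thesis using True unfolding u_def by simp
      next
        case False
        then have wj: "sum_list w \<le> j" using w by simp
        \<comment> \<open>No line stands at \<open>u\<close>, so no jump is made. Passing from
          \<open>c ^ j\<close> to \<open>c ^ Suc j\<close> weakens the induction hypothesis because
          the maximum is at most \<open>D\<close>.\<close>
        have "prodf (insert l S') (\<lambda>x. F' x * ?E (x l))"
          using g by (intro prodf.mult[OF IH(1)] pmf_expectation_bound) auto
        moreover have "card (insert l S') \<le> Suc m"
          using IH(2) prodf_finite[OF IH(1)] by (simp add: card_insert_if)
        moreover have "insert l S' \<subseteq> {s + L..t}" using IH(3) lb q by fastforce
        ultimately have "?X \<le> D" by (rule nearD[OF D M N])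
        then have "0 \<le> (c ^ j - c ^ Suc j) * (D - max e1 ?X)"
          using c1(3) e1(3) by (intro mult_nonneg_nonneg) auto
        then have "c ^ j * max e1 ?X + (1 - c ^ j) * D + 2 * real j * e
          \<le> c ^ Suc j * max e1 ?X + (1 - c ^ Suc j) * D + 2 * real (Suc j) * e"
          using e0 by (simp add: algebra_simps)
        moreover have "(\<integral>x. F x * g (x (l + int (sum_list w))) \<partial>M) - (\<integral>x. F x * g (x (l + int (sum_list w))) \<partial>N)
          \<le> c ^ j * max e1 ?X + (1 - c ^ j) * D + 2 * real j * e"
          using g by (intro IH(4)[OF w(1) wj]) auto
        ultimately show ?thesis by linarith
      qed
    qed (use IH in auto)
  qed
qed

end

section \<open>Uniform mixing\<close>

lemma pmf_tail:
  fixes p :: "nat pmf"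
  assumes "0 < e"
  obtains R where "measure p {R<..} \<le> e"
proof -
  have "(\<lambda>R. measure p {R<..}) \<longlonglongrightarrow> measure p (\<Inter>R. {R<..})"
    by (rule measure_pmf.finite_Lim_measure_decseq) (auto simp: decseq_def)
  also have "(\<Inter>R::nat. {R<..}) = {}" by auto
  finally have "(\<lambda>R. measure p {R<..}) \<longlonglongrightarrow> 0" by simp
  then have "eventually (\<lambda>R. measure p {R<..} < e) sequentially"
    using assms by (rule order_tendstoD)
  then show ?thesis using that by (auto simp: eventually_sequentially intro: less_imp_le)
qed

text \<open>\<open>eps(2)\<close> ranges over all natural numbers, also those outside the state
  space, so that the mixing argument never has to mention \<open>G\<close>.\<close>

locale doeblin = imitation +
  fixes B :: "nat list set" and n :: nat and \<epsilon> :: real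
  assumes finite_B: "finite B"
    and letters: "\<And>b. b \<in> B \<Longrightarrow> set b \<subseteq> set_pmf \<theta>"
    and depth_B: "\<And>b. b \<in> B \<Longrightarrow> sum_list b = n"
    and n: "1 \<le> n"
    and eps: "0 < \<epsilon>" "\<And>i. \<exists>b\<in>B. \<epsilon> \<le> pmf (word_pmf P b i) 1"
begin

definition "min_weight = Min (pmf \<theta> ` (\<Union>b\<in>B. set b))"

text \<open>\<open>min_weight ^ n\<close> is the weight kept by prescribing the jumps at
  \<open>n\<close> sites, and \<open>\<epsilon> / card B\<close> is the mass that the averaged words
  put on state 1. The factor 1/2 leaves room for long jumps and for the discrepancy of products with
  fewer coordinates.\<close>

definition "rate = min_weight ^ n * (\<epsilon> / card B) / 2"

lemma B_ne: "B \<noteq> {}" using eps(2)[of 0] by auto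

lemma letter_weights:
  shows "finite (\<Union>b\<in>B. set b)" "(\<Union>b\<in>B. set b) \<noteq> {}" "0 \<notin> (\<Union>b\<in>B. set b)"
    "0 < min_weight" "min_weight \<le> 1" "\<And>k. k \<in> (\<Union>b\<in>B. set b) \<Longrightarrow> min_weight \<le> pmf \<theta> k"
proof -
  let ?W = "\<Union>b\<in>B. set b"
  show fin: "finite ?W" using finite_B by auto
  obtain b where b: "b \<in> B" using B_ne by auto
  then have "b \<noteq> []" using depth_B[of b] n by auto
  then show ne: "?W \<noteq> {}" using b by auto
  show "0 \<notin> ?W" using letters pos by auto
  have "min_weight \<in> pmf \<theta> ` ?W" unfolding min_weight_def using fin ne by (intro Min_in) auto
  then obtain k b where "min_weight = pmf \<theta> k" "b \<in> B" "k \<in> set b" by auto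
  moreover from this have "k \<in> set_pmf \<theta>" using letters[of b] by auto
  ultimately show "0 < min_weight" "min_weight \<le> 1"
    by (auto simp: pmf_le_1 intro: pmf_positive)
  show "min_weight \<le> pmf \<theta> k" if "k \<in> ?W" for k
    unfolding min_weight_def using fin that by (intro Min_le) auto
qed

lemma eps_le: "0 < \<epsilon> / card B" "\<epsilon> / card B \<le> 1"
proof -
  have c: "1 \<le> card B" using B_ne finite_B by (simp add: Suc_le_eq card_gt_0_iff)
  then show "0 < \<epsilon> / card B" using eps by simp
  obtain b where "\<epsilon> \<le> pmf (word_pmf P b 0) 1" using eps(2) by blast
  also have "\<dots> \<le> 1" by (rule pmf_le_1)
  finally have "\<epsilon> \<le> 1" .
  moreover have "\<epsilon> / card B \<le> \<epsilon> / 1" using c eps(1) by (intro divide_left_mono) auto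
  ultimately show "\<epsilon> / card B \<le> 1" by simp
qed

lemma rate: "0 < rate" "rate < 1"
proof -
  have "0 < min_weight ^ n" "min_weight ^ n \<le> 1" using letter_weights(4,5) by (auto simp: power_le_one)
  then show "0 < rate" using half_gt_zero[OF mult_pos_pos[OF _ eps_le(1)]] unfolding rate_def by blast
  have "min_weight ^ n * (\<epsilon> / card B) \<le> 1"
    using \<open>min_weight ^ n \<le> 1\<close> \<open>0 < min_weight ^ n\<close> eps_le by (intro mult_le_one) auto
  moreover have "x / 2 < 1" if "x \<le> 1" for x :: real using that by simp
  ultimately show "rate < 1" unfolding rate_def by blast
qed

text \<open>Dividing by \<open>q\<close> brings \<open>h\<close> into the class of factors bounded
  by 1. In the application \<open>q\<close> is \<open>1 - \<epsilon> / card B\<close>, which may be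
  0.\<close>

lemma near_scaled:
  assumes "near m L D" "chain M s t" "chain N s t" "prodf S F" "card (insert l S) \<le> m"
    "insert l S \<subseteq> {s + L..t}" and h: "\<And>i. \<bar>h i\<bar> \<le> q"
  shows "(\<integral>x. F x * h (x l) \<partial>M) - (\<integral>x. F x * h (x l) \<partial>N) \<le> q * D"
proof (cases "q = 0")
  case True
  then have "h i = 0" for i using h[of i] by simp
  then show ?thesis using True by simp
next
  case False
  then have q: "0 < q" using h[of 0] abs_ge_zero[of "h 0"] by linarith
  have "prodf (insert l S) (\<lambda>x. F x * (h (x l) / q))"
    using q h by (intro prodf.mult[OF assms(4)]) (auto simp: divide_le_eq)
  then have "(\<integral>x. F x * (h (x l) / q) \<partial>M) - (\<integral>x. F x * (h (x l) / q) \<partial>N) \<le> D"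
    by (rule nearD[OF assms(1-3) _ assms(5,6)])
  then show ?thesis using q by (simp add: field_simps)
qed

text \<open>Averaging over the words of \<^term>\<open>B\<close> produces a constant part \<open>\<epsilon> / card B * g 1\<close>, on which two
  chains can only differ through the remaining coordinates.\<close>

lemma word_average:
  assumes M: "chain M s t" and N: "chain N s t" and D: "near (Suc m) L D"
    and e1: "near m L e1" and F: "prodf S F" "card S \<le> m" "S \<subseteq> {s + L..l}" "s + L \<le> l" "l \<le> t"
    and g: "\<And>i. \<bar>g i\<bar> \<le> 1"
  defines "\<eta> \<equiv> \<epsilon> / card B"
  shows "(\<Sum>b\<in>B. (\<integral>x. F x * measure_pmf.expectation (word_pmf P b (x l)) g \<partial>M)
            - (\<integral>x. F x * measure_pmf.expectation (word_pmf P b (x l)) g \<partial>N)) / card B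
         \<le> \<eta> * e1 + (1 - \<eta>) * D"
proof -
  define E where "E b i = measure_pmf.expectation (word_pmf P b i) g" for b i
  define h where "h i = (\<Sum>b\<in>B. E b i) / card B - \<eta> * g 1" for i
  have c: "0 < real (card B)" using B_ne finite_B by (simp add: card_gt_0_iff)
  \<comment> \<open>Only the mass off state 1 contributes to the difference.\<close>
  have E1: "\<bar>E b i - pmf (word_pmf P b i) 1 * g 1\<bar> \<le> 1 - pmf (word_pmf P b i) 1" for b i
  proof -
    let ?p = "word_pmf P b i"
    have int: "integrable ?p g" "integrable ?p (\<lambda>j. indicator {1} j * g j)" "integrable ?p (indicator {1} :: nat \<Rightarrow> real)"
      "integrable ?p (\<lambda>j. \<bar>g j - indicator {1} j * g j\<bar>)" "integrable ?p (\<lambda>j. 1 - indicator {1} j :: real)"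
      by (rule measure_pmf.integrable_const_bound[of _ 1]; use g in \<open>auto simp: indicator_def\<close>)+
    have "(\<integral>j. indicator {1} j * g j \<partial>?p) = (\<integral>j. g 1 * indicator {1} j \<partial>?p)"
      by (intro Bochner_Integration.integral_cong) (auto simp: indicator_def)
    then have "E b i - pmf ?p 1 * g 1 = (\<integral>j. g j - indicator {1} j * g j \<partial>?p)"
      unfolding E_def using int by (simp add: measure_pmf_single)
    also have "\<bar>\<dots>\<bar> \<le> (\<integral>j. \<bar>g j - indicator {1} j * g j\<bar> \<partial>?p)"
      by (rule integral_abs_bound)
    also have "\<dots> \<le> (\<integral>j. 1 - indicator {1} j \<partial>?p)"
      by (rule integral_mono[OF int(4,5)]) (use g in \<open>auto simp: indicator_def\<close>)
    also have "\<dots> = 1 - pmf ?p 1" using int by (simp add: measure_pmf_single)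
    finally show ?thesis .
  qed
  \<comment> \<open>Some word serves \<open>i\<close>, so the masses at 1 add up to
    \<open>\<sigma> \<ge> \<epsilon>\<close>. Replacing \<open>\<sigma>\<close> by the state-free
    \<epsilon> costs at most \<open>\<sigma> - \<epsilon>\<close>, which the bound
    \<open>card B - \<sigma>\<close> makes up for.\<close>
  have h: "\<bar>h i\<bar> \<le> 1 - \<eta>" for i
  proof -
    obtain b0 where b0: "b0 \<in> B" "\<epsilon> \<le> pmf (word_pmf P b0 i) 1" using eps(2) by blast
    define \<sigma> where "\<sigma> = (\<Sum>b\<in>B. pmf (word_pmf P b i) 1)"
    have "\<epsilon> \<le> \<sigma>"
      unfolding \<sigma>_def using b0 finite_B member_le_sum[of b0 B "\<lambda>b. pmf (word_pmf P b i) 1"] by force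
    have "\<bar>(\<Sum>b\<in>B. E b i) - \<sigma> * g 1\<bar> = \<bar>\<Sum>b\<in>B. E b i - pmf (word_pmf P b i) 1 * g 1\<bar>"
      unfolding \<sigma>_def by (simp add: sum_subtractf sum_distrib_right)
    also have "\<dots> \<le> (\<Sum>b\<in>B. 1 - pmf (word_pmf P b i) 1)"
      by (intro order_trans[OF sum_abs] sum_mono E1)
    also have "\<dots> = card B - \<sigma>" unfolding \<sigma>_def by (simp add: sum_subtractf)
    finally have 1: "\<bar>(\<Sum>b\<in>B. E b i) - \<sigma> * g 1\<bar> \<le> card B - \<sigma>" .
    have "\<bar>\<sigma> * g 1 - \<epsilon> * g 1\<bar> = (\<sigma> - \<epsilon>) * \<bar>g 1\<bar>"
      using \<open>\<epsilon> \<le> \<sigma>\<close> by (simp add: abs_mult flip: left_diff_distrib)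
    also have "\<dots> \<le> \<sigma> - \<epsilon>"
      using \<open>\<epsilon> \<le> \<sigma>\<close> g by (intro mult_left_le) auto
    finally have "\<bar>(\<Sum>b\<in>B. E b i) - \<epsilon> * g 1\<bar> \<le> card B - \<epsilon>" using 1 by linarith
    then have "\<bar>((\<Sum>b\<in>B. E b i) - \<epsilon> * g 1) / card B\<bar> \<le> (card B - \<epsilon>) / card B"
      using c by (simp add: divide_right_mono)
    also have "((\<Sum>b\<in>B. E b i) - \<epsilon> * g 1) / card B = h i"
      unfolding h_def \<eta>_def by (simp add: diff_divide_distrib)
    also have "(card B - \<epsilon>) / card B = 1 - \<eta>"
      unfolding \<eta>_def using c by (simp add: diff_divide_distrib)
    finally show ?thesis .
  qed
  have St: "S \<subseteq> {s + L..t}" "insert l S \<subseteq> {s + L..t}" using F(3-5) by auto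
  have card: "card (insert l S) \<le> Suc m"
    using F(2) prodf_finite[OF F(1)] by (simp add: card_insert_if)
  have split: "(\<Sum>b\<in>B. \<integral>x. F x * E b (x l) \<partial>Q) / card B = (\<integral>x. F x * h (x l) \<partial>Q) + \<eta> * g 1 * (\<integral>x. F x \<partial>Q)"
    if Q: "chain Q s t" for Q
  proof -
    have int: "integrable Q (\<lambda>x. F x * E b (x l))" for b
      unfolding E_def
      by (rule chain_integrable(1)[OF Q prodf.mult[OF F(1)]]) (intro pmf_expectation_bound g)
    have intF: "integrable Q F" by (rule chain_integrable[OF Q F(1)])
    have "(\<Sum>b\<in>B. \<integral>x. F x * E b (x l) \<partial>Q) / card B = (\<integral>x. (\<Sum>b\<in>B. F x * E b (x l)) / card B \<partial>Q)"
      using int by simp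
    also have "\<dots> = (\<integral>x. F x * h (x l) + \<eta> * g 1 * F x \<partial>Q)"
      unfolding h_def by (intro Bochner_Integration.integral_cong)
        (auto simp: algebra_simps sum_distrib_left)
    also have "\<dots> = (\<integral>x. F x * h (x l) \<partial>Q) + \<eta> * g 1 * (\<integral>x. F x \<partial>Q)"
    proof -
      have "integrable Q (\<lambda>x. F x * h (x l))"
        by (rule chain_integrable(1)[OF Q prodf.mult[OF F(1)]])
          (use h eps_le in \<open>force simp flip: \<eta>_def intro: order_trans\<close>)
      then show ?thesis using intF by simp
    qed
    finally show ?thesis .
  qed
  have "(\<Sum>b\<in>B. (\<integral>x. F x * E b (x l) \<partial>M) - (\<integral>x. F x * E b (x l) \<partial>N)) / card B
      = ((\<integral>x. F x * h (x l) \<partial>M) - (\<integral>x. F x * h (x l) \<partial>N)) + \<eta> * g 1 * ((\<integral>x. F x \<partial>M) - (\<integral>x. F x \<partial>N))"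
    using split[OF M] split[OF N] by (simp add: sum_subtractf diff_divide_distrib right_diff_distrib)
  also have "\<dots> \<le> (1 - \<eta>) * D + \<eta> * e1"
  proof (rule add_mono)
    show "(\<integral>x. F x * h (x l) \<partial>M) - (\<integral>x. F x * h (x l) \<partial>N) \<le> (1 - \<eta>) * D"
      by (rule near_scaled[OF D M N F(1) card St(2) h])
    \<comment> \<open>Both orders of the two laws are used, because \<open>g 1\<close> may be
      negative.\<close>
    have *: "\<bar>(\<integral>x. F x \<partial>M) - (\<integral>x. F x \<partial>N)\<bar> \<le> e1"
      using nearD[OF e1 M N F(1,2) St(1)] nearD[OF e1 N M F(1,2) St(1)] by linarith
    have "g 1 * ((\<integral>x. F x \<partial>M) - (\<integral>x. F x \<partial>N)) \<le> \<bar>g 1\<bar> * \<bar>(\<integral>x. F x \<partial>M) - (\<integral>x. F x \<partial>N)\<bar>"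
      unfolding abs_mult[symmetric] by (rule abs_ge_self)
    also have "\<dots> \<le> 1 * \<bar>(\<integral>x. F x \<partial>M) - (\<integral>x. F x \<partial>N)\<bar>"
      by (intro mult_right_mono g) auto
    also have "\<dots> \<le> e1" using * by simp
    finally have "g 1 * ((\<integral>x. F x \<partial>M) - (\<integral>x. F x \<partial>N)) \<le> e1" .
    then show "\<eta> * g 1 * ((\<integral>x. F x \<partial>M) - (\<integral>x. F x \<partial>N)) \<le> \<eta> * e1"
      using eps_le unfolding \<eta>_def[symmetric] by (simp add: mult.assoc)
  qed
  finally show ?thesis unfolding E_def by simp
qed

text \<open>Spends one block of \<open>n\<close> sites below the topmost coordinate. The bound from
  \<open>descend\<close> holds for every word of \<open>B\<close>, so a word whose discrepancy does
  not exceed the bound on the average may be selected.\<close>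

lemma contract:
  assumes D: "near (Suc m) L D" "0 < D" and IH: "\<And>e. 0 < e \<Longrightarrow> \<exists>L. near m L e"
  shows "\<exists>L. near (Suc m) L ((1 - rate) * D)"
proof -
  let ?W = "\<Union>b\<in>B. set b"
  \<comment> \<open>The gain is \<open>2 * rate * (D - e1)\<close>, that is
    \<open>3/2 * rate * D\<close>. The tail terms \<open>2 * real n * e\<close> consume
    \<open>rate * D / 2\<close> of it and leave \<open>rate * D\<close>.\<close>
  define e1 where "e1 = D / 4"
  define e where "e = rate * D / (4 * real n)"
  have e1: "0 < e1" "e1 \<le> D" using D(2) by (auto simp: e1_def)
  have e: "0 < e" using D(2) rate n by (auto simp: e_def)
  obtain L1 where L1: "near m L1 e1" using IH[OF e1(1)] by blast
  obtain R0 where R0: "measure \<theta> {R0<..} \<le> e" using pmf_tail[OF e] by blast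
  \<comment> \<open>Large enough for the tail bound and for every letter of a word.\<close>
  define R where "R = max R0 (Max ?W)"
  have WR: "?W \<subseteq> {..R}" using letter_weights(1) by (auto simp: R_def intro!: le_max_iff_disj[THEN iffD2] disjI2 Max_ge)
  obtain a where a: "a \<in> ?W" using letter_weights(2) by blast
  then have R1: "1 \<le> R" using WR letter_weights(3) by (metis One_nat_def Suc_leI atMost_iff gr0I le_trans subsetD)
  have "measure \<theta> {R<..} \<le> measure \<theta> {R0<..}"
    by (rule measure_pmf.finite_measure_mono) (auto simp: R_def)
  then have tail: "measure \<theta> {R<..} \<le> e" using R0 by simp
  define L0 where "L0 = max 0 (max L L1)"
  have n1: "near (Suc m) L0 D" "near m L0 e1" "0 \<le> L0"
    using near_mono[OF D(1)] near_mono[OF L1] by (auto simp: L0_def)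
  \<comment> \<open>Room for the block itself, for one jump of length at most \<open>R\<close> at
    each of its sites, and for the margin \<open>L0\<close> below.\<close>
  define L' where "L' = L0 + int R * int n + int n"
  have "near (Suc m) L' ((1 - rate) * D)"
  proof (rule nearI)
    fix M N s t S F
    assume M: "chain M s t" and N: "chain N s t" and F: "prodf S F" "card S \<le> Suc m" "S \<subseteq> {s + L'..t}"
    have finS: "finite S" using F(1) by (rule prodf_finite)
    show "(\<integral>x. F x \<partial>M) - (\<integral>x. F x \<partial>N) \<le> (1 - rate) * D"
    proof (cases "S = {}")
      case True
      have "(\<integral>x. F x \<partial>M) - (\<integral>x. F x \<partial>N) \<le> 0"
        by (rule nearD[OF near_0 M N F(1) _ F(3)]) (use True in auto)
      also have "0 \<le> (1 - rate) * D" using rate D(2) by simp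
      finally show ?thesis .
    next
      case False
      define u where "u = Max S"
      have u: "u \<in> S" "\<And>x. x \<in> S \<Longrightarrow> x \<le> u" using finS False by (auto simp: u_def)
      obtain F0 g where F0: "prodf (S - {u}) F0" "\<And>i. \<bar>g i\<bar> \<le> 1" "F = (\<lambda>x. F0 x * g (x u))"
        using prodf_extract[OF F(1), of u] by blast
      define l where "l = u - int n"
      have lu: "l + int n = u" by (simp add: l_def)
      have l: "s + L0 + int R * int n \<le> l" "l + int n \<le> t"
        using F(3) u(1) unfolding l_def L'_def by auto
      have l0: "s + L0 \<le> l" "l \<le> t"
        using l zero_le_mult_iff[of "int R" "int n"] by linarith+
      have cS: "card (S - {u}) \<le> m" using F(2) u(1) finS by simp
      have S0: "S - {u} \<subseteq> {s + L0 + int R * int n..l + int n}"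
        unfolding lu using F(3) u(2) unfolding L'_def by fastforce
      obtain S' F' where *: "prodf S' F'" "card S' \<le> m" "S' \<subseteq> {s + L0..l}"
        "\<And>w g. set w \<subseteq> ?W \<Longrightarrow> sum_list w \<le> n \<Longrightarrow> (\<And>i. \<bar>g i\<bar> \<le> 1) \<Longrightarrow>
         (\<integral>x. F0 x * g (x (l + int (sum_list w))) \<partial>M) - (\<integral>x. F0 x * g (x (l + int (sum_list w))) \<partial>N)
          \<le> min_weight ^ n * max e1 ((\<integral>x. F' x * measure_pmf.expectation (word_pmf P w (x l)) g \<partial>M)
                   - (\<integral>x. F' x * measure_pmf.expectation (word_pmf P w (x l)) g \<partial>N))
             + (1 - min_weight ^ n) * D + 2 * real n * e"
        using descend[OF M N n1(3) R1 n1(1,2) less_imp_le[OF e1(1)] e1(2) WR letter_weights(6)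
            less_imp_le[OF letter_weights(4)] letter_weights(5,3) a tail F0(1) cS S0 l] by blast
      define X where "X b = (\<integral>x. F' x * measure_pmf.expectation (word_pmf P b (x l)) g \<partial>M)
                   - (\<integral>x. F' x * measure_pmf.expectation (word_pmf P b (x l)) g \<partial>N)" for b
      define d where "d = (\<integral>x. F x \<partial>M) - (\<integral>x. F x \<partial>N)"
      define \<eta> where "\<eta> = \<epsilon> / card B"
      have \<eta>: "0 < \<eta>" "\<eta> \<le> 1" using eps_le by (auto simp: \<eta>_def)
      have dX: "d \<le> min_weight ^ n * max e1 (X b) + (1 - min_weight ^ n) * D + 2 * real n * e" if "b \<in> B" for b
        using *(4)[of b g] that depth_B[OF that] F0(2) unfolding d_def X_def F0(3) lu[symmetric] by auto
      have "\<exists>b\<in>B. max e1 (X b) \<le> \<eta> * e1 + (1 - \<eta>) * D"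
      proof (rule ccontr)
        assume none: "\<not> ?thesis"
        \<comment> \<open>As \<open>e1\<close> does not exceed the bound for the average, a
          violation must come from \<open>X b\<close>.\<close>
        have "(1 - \<eta>) * e1 \<le> (1 - \<eta>) * D" using \<eta> e1 by (intro mult_left_mono) auto
        then have "e1 \<le> \<eta> * e1 + (1 - \<eta>) * D" by (simp add: algebra_simps)
        then have "\<eta> * e1 + (1 - \<eta>) * D < X b" if "b \<in> B" for b using none that by force
        then have "(\<Sum>b\<in>B. \<eta> * e1 + (1 - \<eta>) * D) < (\<Sum>b\<in>B. X b)"
          using finite_B B_ne by (intro sum_strict_mono) auto
        then have "\<eta> * e1 + (1 - \<eta>) * D < (\<Sum>b\<in>B. X b) / card B"
          using finite_B B_ne by (simp add: field_simps card_gt_0_iff)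
        also have "\<dots> \<le> \<eta> * e1 + (1 - \<eta>) * D"
          unfolding X_def \<eta>_def
          by (rule word_average[OF M N n1(1,2) *(1-3) l0 F0(2)])
        finally show False by simp
      qed
      then obtain b where b: "b \<in> B" "max e1 (X b) \<le> \<eta> * e1 + (1 - \<eta>) * D" by blast
      have "d \<le> min_weight ^ n * (\<eta> * e1 + (1 - \<eta>) * D) + (1 - min_weight ^ n) * D + 2 * real n * e"
        using dX[OF b(1)] mult_left_mono[OF b(2), of "min_weight ^ n"] zero_le_power[OF less_imp_le[OF letter_weights(4)], of n]
        by linarith
      also have "\<dots> = D - min_weight ^ n * \<eta> * (D - e1) + 2 * real n * e" by (simp add: algebra_simps)
      also have "min_weight ^ n * \<eta> * (D - e1) = 2 * rate * (3 / 4 * D)"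
        unfolding rate_def \<eta>_def e1_def by simp
      also have "2 * real n * e = rate * D / 2" using n unfolding e_def by simp
      also have "D - 2 * rate * (3 / 4 * D) + rate * D / 2 = (1 - rate) * D" by (simp add: algebra_simps)
      finally show ?thesis unfolding d_def .
    qed
  qed
  then show ?thesis by blast
qed

text \<open>The factor \<open>1 - rate\<close> depends neither on \<open>m\<close> nor on
  \<open>D\<close> or \<open>L\<close>. Iterating \<open>contract\<close> from the trivial bound 2
  therefore decays geometrically, while only the required distance \<open>L\<close> grows; the case
  of \<open>m\<close> coordinates enters through the small error that each contraction
  allows.\<close>

theorem mixing: "0 < e \<Longrightarrow> \<exists>L. near m L e"
proof (induction m arbitrary: e)
  case 0
  have "near 0 0 e" using near_mono[OF near_0, of 0 0 e] 0 by simp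
  then show ?case by blast
next
  case (Suc m)
  note IH = Suc.IH
  have "\<exists>L. near (Suc m) L ((1 - rate) ^ j * 2)" for j
  proof (induction j)
    case 0
    show ?case using near_2 by simp
  next
    case (Suc j)
    then obtain L where L: "near (Suc m) L ((1 - rate) ^ j * 2)" by blast
    show ?case
      using contract[OF L _ IH] rate by (simp add: mult.assoc)
  qed
  moreover have "(\<lambda>j. (1 - rate) ^ j * 2) \<longlonglongrightarrow> 0 * 2"
    using rate by (intro tendsto_mult LIMSEQ_realpow_zero tendsto_const) auto
  then have "eventually (\<lambda>j. (1 - rate) ^ j * 2 < e) sequentially"
    using Suc.prems by (intro order_tendstoD) auto
  then obtain j where j: "(1 - rate) ^ j * 2 < e" by (auto simp: eventually_sequentially)
  ultimately obtain L where "near (Suc m) L ((1 - rate) ^ j * 2)" by blast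
  from near_mono[OF this order_refl less_imp_le[OF j]] show ?case by blast
qed

end

section \<open>Compatible laws\<close>

text \<open>The second factor is countable, so joint measurability follows from that of the
  sections.\<close>

lemma measurable_pmf_pair:
  fixes \<phi> :: "'k::countable \<Rightarrow> 'a \<Rightarrow> real" and \<theta> :: "'k pmf"
  assumes "\<And>k. \<phi> k \<in> borel_measurable M"
  shows "(\<lambda>(x, k). \<phi> k x) \<in> borel_measurable (M \<Otimes>\<^sub>M measure_pmf \<theta>)"
proof -
  have "(\<lambda>p. \<phi> (snd p) (fst p)) \<in> borel_measurable (M \<Otimes>\<^sub>M measure_pmf \<theta>)"
    by (rule measurable_compose_countable'[where f = "\<lambda>k p. \<phi> k (fst p)" and g = snd and I = UNIV])
       (use assms in \<open>auto intro: measurable_compose[OF measurable_fst]\<close>)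
  then show ?thesis by (simp add: case_prod_beta')
qed

lemma measurable_pmf_integral:
  fixes \<phi> :: "'k::countable \<Rightarrow> 'a \<Rightarrow> real" and \<theta> :: "'k pmf"
  assumes "\<And>k. \<phi> k \<in> borel_measurable M"
  shows "(\<lambda>x. \<integral>k. \<phi> k x \<partial>\<theta>) \<in> borel_measurable M"
  by (rule measure_pmf.borel_measurable_lebesgue_integral[OF measurable_pmf_pair[OF assms]])

lemma pmf_integral_swap:
  fixes \<phi> :: "'k::countable \<Rightarrow> 'a \<Rightarrow> real" and \<theta> :: "'k pmf"
  assumes "prob_space M" and \<phi>: "\<And>k. \<phi> k \<in> borel_measurable M" "\<And>k x. \<bar>\<phi> k x\<bar> \<le> C"
  shows "(\<integral>k. (\<integral>x. \<phi> k x \<partial>M) \<partial>\<theta>) = (\<integral>x. (\<integral>k. \<phi> k x \<partial>\<theta>) \<partial>M)"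
proof -
  interpret M: prob_space M by fact
  interpret pair_prob_space M "measure_pmf \<theta>" ..
  have "integrable (M \<Otimes>\<^sub>M measure_pmf \<theta>) (\<lambda>(x, k). \<phi> k x)"
    by (rule P.integrable_const_bound[of _ C]) (use \<phi> measurable_pmf_pair[OF \<phi>(1)] in auto)
  then show ?thesis by (rule Fubini_integral)
qed

section \<open>Path space, the past and its cylinders\<close>

lemma space_path_space: "space (path_space G) = {x. \<forall>m. x m \<in> G}"
  by (auto simp: path_space_def space_PiM)

lemma coordinate_path_space: "(\<lambda>x. x m) \<in> path_space G \<rightarrow>\<^sub>M count_space UNIV"
proof -
  have "(\<lambda>x. x m) \<in> path_space G \<rightarrow>\<^sub>M count_space G"
    unfolding path_space_def by (rule measurable_component_singleton) simp
  then show ?thesis by (rule measurable_compose) simp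
qed

lemma space_past_algebra: "space (past_algebra G n) = space (path_space G)"
  unfolding past_algebra_def by (rule space_measure_of) auto

lemma sets_past_algebra:
  "sets (past_algebra G n) = sigma_sets (space (path_space G))
      {{x \<in> space (path_space G). x m = g} | m g. m < n \<and> g \<in> G}"
  unfolding past_algebra_def by (rule sets_measure_of) auto

lemma coordinate_past_algebra:
  assumes "m < n"
  shows "(\<lambda>x. x m) \<in> past_algebra G n \<rightarrow>\<^sub>M count_space UNIV"
proof -
  have "(\<lambda>x. x m) -` {a} \<inter> space (past_algebra G n) \<in> sets (past_algebra G n)" for a
  proof (cases "a \<in> G")
    case True
    have "(\<lambda>x. x m) -` {a} \<inter> space (path_space G) = {x \<in> space (path_space G). x m = a}" by auto
    then show ?thesis
      unfolding sets_past_algebra space_past_algebra using True assms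
      by (auto intro!: sigma_sets.Basic)
  next
    case False
    then have "(\<lambda>x. x m) -` {a} \<inter> space (past_algebra G n) = {}"
      by (auto simp: space_past_algebra space_path_space)
    then show ?thesis by simp
  qed
  then show ?thesis by (simp add: measurable_count_space_eq2_countable)
qed

lemma subalgebra_past:
  assumes "sets M = sets (path_space G)"
  shows "subalgebra M (past_algebra G n)"
proof -
  have sp: "space M = space (path_space G)" using assms by (rule sets_eq_imp_space_eq)
  have "{x \<in> space (path_space G). x m = g} \<in> sets (path_space G)" for m g
    using measurable_sets[OF coordinate_path_space, of "{g}" m G]
    by (simp add: vimage_def Int_def conj_commute)
  then have "sets (past_algebra G n) \<subseteq> sets (path_space G)"
    unfolding sets_past_algebra by (intro sets.sigma_sets_subset) auto
  then show ?thesis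
    by (simp add: subalgebra_def sp space_past_algebra assms)
qed

text \<open>The generators of \<open>past_algebra\<close> constrain a single coordinate and are not
  closed under intersection. These sets are, and their indicators are products in the sense of
  \<open>prodf\<close>.\<close>

definition cylinders :: "nat set \<Rightarrow> int \<Rightarrow> (int \<Rightarrow> nat) set set" where
  "cylinders G n = {{x \<in> space (path_space G). \<forall>s\<in>S. x s \<in> Y s} | S Y. finite S \<and> S \<subseteq> {..<n}}"

lemma Int_stable_cylinders: "Int_stable (cylinders G n)"
proof (rule Int_stableI)
  fix a b assume "a \<in> cylinders G n" "b \<in> cylinders G n"
  then obtain S Y S' Y' where a: "a = {x \<in> space (path_space G). \<forall>s\<in>S. x s \<in> Y s}" "finite S" "S \<subseteq> {..<n}"
    and b: "b = {x \<in> space (path_space G). \<forall>s\<in>S'. x s \<in> Y' s}" "finite S'" "S' \<subseteq> {..<n}"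
    unfolding cylinders_def by blast
  let ?Z = "\<lambda>s. (if s \<in> S then Y s else UNIV) \<inter> (if s \<in> S' then Y' s else UNIV)"
  have "a \<inter> b = {x \<in> space (path_space G). \<forall>s\<in>S \<union> S'. x s \<in> ?Z s}"
    unfolding a b by (auto split: if_splits)
  then show "a \<inter> b \<in> cylinders G n"
    unfolding cylinders_def using a b by (intro CollectI exI[of _ "S \<union> S'"] exI[of _ ?Z]) auto
qed

lemma sets_past_algebra_cylinders:
  "sets (past_algebra G n) \<subseteq> sigma_sets (space (path_space G)) (cylinders G n)"
proof -
  have "{x \<in> space (path_space G). x m = g} \<in> cylinders G n" if "m < n" for m g
    unfolding cylinders_def using that
    by (intro CollectI exI[of _ "{m}"] exI[of _ "\<lambda>_. {g}"]) auto
  then show ?thesis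
    unfolding sets_past_algebra by (intro sigma_sets_mono') auto
qed

lemma prodf_cylinder:
  assumes "finite S"
  shows "prodf S (\<lambda>x. of_bool (\<forall>s\<in>S. x s \<in> Y s))"
  using assms
proof (induction S rule: finite_induct)
  case empty
  then show ?case by (simp add: prodf.one)
next
  case (insert s S)
  have "prodf (insert s S) (\<lambda>x. of_bool (\<forall>s\<in>S. x s \<in> Y s) * of_bool (x s \<in> Y s))"
    by (rule prodf.mult[OF insert.IH]) auto
  also have "(\<lambda>x. of_bool (\<forall>s\<in>S. x s \<in> Y s) * of_bool (x s \<in> Y s))
      = (\<lambda>x. of_bool (\<forall>s\<in>insert s S. x s \<in> Y s) :: real)"
    by auto
  finally show ?case .
qed

section \<open>Conditional laws and expansion over jumps\<close>

context imitation
begin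

definition ker :: "int \<Rightarrow> (int \<Rightarrow> nat) \<Rightarrow> nat pmf" where
  "ker u x = bind_pmf \<theta> (\<lambda>k. P k (x (u - int k)))"

lemma pmf_ker: "pmf (ker u x) g = (\<integral>k. pmf (P k (x (u - int k))) g \<partial>\<theta>)"
  unfolding ker_def by (rule pmf_bind)

lemma expectation_ker:
  "(\<And>i. \<bar>h i\<bar> \<le> C) \<Longrightarrow> measure_pmf.expectation (ker u x) h = (\<integral>k. lift k h (x (u - int k)) \<partial>\<theta>)"
  unfolding ker_def lift_def by (rule pmf_expectation_bind)

lemma measurable_expectation_ker:
  fixes h :: "nat \<Rightarrow> real"
  assumes "\<And>k. k \<in> set_pmf \<theta> \<Longrightarrow> (\<lambda>x. x (u - int k)) \<in> M \<rightarrow>\<^sub>M count_space UNIV"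
    and h: "\<And>i. \<bar>h i\<bar> \<le> C"
  shows "(\<lambda>x. measure_pmf.expectation (ker u x) h) \<in> borel_measurable M"
proof -
  \<comment> \<open>The jump 0 would read the site \<open>u\<close> itself, which is not measurable
    with respect to the past of \<open>u\<close>. It has mass 0, so its term is replaced by
    0.\<close>
  have eq: "(\<integral>k. lift k h (x (u - int k)) \<partial>\<theta>)
      = (\<integral>k. (if k \<in> set_pmf \<theta> then lift k h (x (u - int k)) else 0) \<partial>\<theta>)" for x
    by (intro integral_cong_AE) (auto simp: AE_measure_pmf_iff)
  have "(\<lambda>x. if k \<in> set_pmf \<theta> then lift k h (x (u - int k)) else 0) \<in> borel_measurable M" for k
    by (cases "k \<in> set_pmf \<theta>") (use assms(1) in \<open>auto intro: measurable_compose\<close>)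
  then show ?thesis
    unfolding expectation_ker[OF h] eq by (rule measurable_pmf_integral)
qed

lemma measurable_pmf_ker:
  assumes "\<And>k. k \<in> set_pmf \<theta> \<Longrightarrow> (\<lambda>x. x (u - int k)) \<in> M \<rightarrow>\<^sub>M count_space UNIV"
  shows "(\<lambda>x. pmf (ker u x) g) \<in> borel_measurable M"
proof -
  have "(\<lambda>x. measure_pmf.expectation (ker u x) (indicat_real {g})) \<in> borel_measurable M"
    using assms by (rule measurable_expectation_ker) (auto simp: indicator_def)
  then show ?thesis by (simp add: measure_pmf_single)
qed

text \<open>By Fubini. With the jump integrated outside, the identity describes ancestral lines;
  integrated inside, it becomes a statement on conditional expectations.\<close>

lemma chain_iff_ker:
  "chain M s t \<longleftrightarrow> prob_space M \<and> (\<forall>u. (\<lambda>x. x u) \<in> M \<rightarrow>\<^sub>M count_space UNIV) \<and>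
    (\<forall>u F S h. s < u \<longrightarrow> u \<le> t \<longrightarrow> prodf S F \<longrightarrow> S \<subseteq> {..<u} \<longrightarrow> (\<forall>i. \<bar>h i\<bar> \<le> 1) \<longrightarrow>
       (\<integral>x. F x * h (x u) \<partial>M) = (\<integral>x. F x * measure_pmf.expectation (ker u x) h \<partial>M))"
proof -
  have eq: "(\<integral>k. (\<integral>x. F x * lift k h (x (u - int k)) \<partial>M) \<partial>\<theta>) = (\<integral>x. F x * measure_pmf.expectation (ker u x) h \<partial>M)"
    if M: "prob_space M" "\<forall>u. (\<lambda>x. x u) \<in> M \<rightarrow>\<^sub>M count_space UNIV" and F: "prodf S F" and h: "\<forall>i. \<bar>h i\<bar> \<le> 1"
    for u F S h
  proof -
    have [measurable]: "F \<in> borel_measurable M" using M(2) by (intro prodf_measurable[OF F]) auto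
    have "(\<integral>k. (\<integral>x. F x * lift k h (x (u - int k)) \<partial>M) \<partial>\<theta>) = (\<integral>x. (\<integral>k. F x * lift k h (x (u - int k)) \<partial>\<theta>) \<partial>M)"
    proof (rule pmf_integral_swap[OF M(1)])
      show "(\<lambda>x. F x * lift k h (x (u - int k))) \<in> borel_measurable M" for k
        using M(2) by (intro borel_measurable_times) (auto intro: measurable_compose)
      show "\<bar>F x * lift k h (x (u - int k))\<bar> \<le> 1" for k x
        unfolding abs_mult using h by (intro mult_le_one prodf_bound[OF F] lift_bound) auto
    qed
    also have "\<dots> = (\<integral>x. F x * measure_pmf.expectation (ker u x) h \<partial>M)"
      using h by (subst expectation_ker[of h 1]) auto
    finally show ?thesis .
  qed
  show ?thesis
    unfolding chain_def
    by (intro conj_cong refl all_cong1 imp_cong, rule arg_cong[where f = "\<lambda>y. _ = y"], rule eq; assumption)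
qed

text \<open>Compatibility only speaks of single states. A bounded \<open>h\<close> is a limit of
  finite combinations of their indicators, and both sides pass to the limit by dominated
  convergence.\<close>

lemma chainI_indicator:
  assumes M: "prob_space M" and coord: "\<And>u. (\<lambda>x. x u) \<in> M \<rightarrow>\<^sub>M count_space UNIV"
    and ind: "\<And>u F S g. s < u \<Longrightarrow> u \<le> t \<Longrightarrow> prodf S F \<Longrightarrow> S \<subseteq> {..<u} \<Longrightarrow>
       (\<integral>x. F x * of_bool (x u = g) \<partial>M) = (\<integral>x. F x * pmf (ker u x) g \<partial>M)"
  shows "chain M s t"
  unfolding chain_iff_ker
proof (intro conjI allI impI)
  fix u F S and h :: "nat \<Rightarrow> real"
  assume u: "s < u" "u \<le> t" and F: "prodf S F" "S \<subseteq> {..<u}" and h: "\<forall>i. \<bar>h i\<bar> \<le> 1"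
  interpret prob_space M by fact
  note [measurable] = coord
  have [measurable]: "F \<in> borel_measurable M" by (rule prodf_measurable[OF F(1)]) (rule coord)
  \<comment> \<open>The truncation leaves a finite sum over states, so no sum has to be exchanged
    with an integral.\<close>
  define hN where "hN N i = (if i < N then h i else 0)" for N i
  have hN: "\<bar>hN N i\<bar> \<le> 1" for N i using h by (simp add: hN_def)
  have hN_lim: "(\<lambda>N. hN N i) \<longlonglongrightarrow> h i" for i
    by (rule tendsto_eventually) (auto simp: hN_def eventually_sequentially intro!: exI[of _ "Suc i"])
  have meas: "(\<lambda>x. measure_pmf.expectation (ker u x) f) \<in> borel_measurable M" if "\<And>i. \<bar>f i\<bar> \<le> 1" for f :: "nat \<Rightarrow> real"
    by (rule measurable_expectation_ker[OF coord that])
  have meas_pmf [measurable]: "(\<lambda>x. pmf (ker u x) g) \<in> borel_measurable M" for g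
    by (rule measurable_pmf_ker) (rule coord)
  have bF: "\<bar>F x * y\<bar> \<le> 1" if "\<bar>y\<bar> \<le> 1" for x y
    unfolding abs_mult using that by (intro mult_le_one prodf_bound[OF F(1)]) auto
  have eqN: "(\<integral>x. F x * hN N (x u) \<partial>M) = (\<integral>x. F x * measure_pmf.expectation (ker u x) (hN N) \<partial>M)" for N
  proof -
    have 1: "hN N i = (\<Sum>g<N. h g * of_bool (i = g))" for i
      by (auto simp: hN_def if_distrib of_bool_def cong: if_cong)
    have 2: "measure_pmf.expectation (ker u x) (hN N) = (\<Sum>g<N. h g * pmf (ker u x) g)" for x
      by (subst integral_measure_pmf_real[of "{..<N}"]) (auto simp: hN_def split: if_splits)
    have int: "integrable M (\<lambda>x. F x * of_bool (x u = g))" "integrable M (\<lambda>x. F x * pmf (ker u x) g)" for g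
      by (rule integrable_const_bound[of _ 1]; use bF in \<open>auto simp: pmf_le_1 intro!: AE_I2\<close>)+
    have "(\<integral>x. F x * hN N (x u) \<partial>M) = (\<integral>x. (\<Sum>g<N. h g * (F x * of_bool (x u = g))) \<partial>M)"
      unfolding 1 sum_distrib_left by (intro Bochner_Integration.integral_cong refl sum.cong) (simp only: mult_ac)
    also have "\<dots> = (\<Sum>g<N. h g * (\<integral>x. F x * of_bool (x u = g) \<partial>M))"
      using int by simp
    also have "\<dots> = (\<Sum>g<N. h g * (\<integral>x. F x * pmf (ker u x) g \<partial>M))"
      using ind[OF u F] by simp
    also have "\<dots> = (\<integral>x. (\<Sum>g<N. h g * (F x * pmf (ker u x) g)) \<partial>M)"
      using int by simp
    also have "\<dots> = (\<integral>x. F x * measure_pmf.expectation (ker u x) (hN N) \<partial>M)"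
      unfolding 2 sum_distrib_left by (intro Bochner_Integration.integral_cong refl sum.cong) (simp only: mult_ac)
    finally show ?thesis .
  qed
  have "(\<lambda>N. \<integral>x. F x * hN N (x u) \<partial>M) \<longlonglongrightarrow> (\<integral>x. F x * h (x u) \<partial>M)"
  proof (rule integral_dominated_convergence[where w = "\<lambda>_. 1"])
    show "AE x in M. (\<lambda>N. F x * hN N (x u)) \<longlonglongrightarrow> F x * h (x u)"
      by (intro AE_I2 tendsto_intros hN_lim)
    show "AE x in M. norm (F x * hN N (x u)) \<le> 1" for N
      using bF[OF hN] by simp
  qed (auto intro: measurable_compose[OF coord])
  moreover have "(\<lambda>N. \<integral>x. F x * measure_pmf.expectation (ker u x) (hN N) \<partial>M)
      \<longlonglongrightarrow> (\<integral>x. F x * measure_pmf.expectation (ker u x) h \<partial>M)"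
  proof (rule integral_dominated_convergence[where w = "\<lambda>_. 1"])
    have "(\<lambda>N. measure_pmf.expectation (ker u x) (hN N)) \<longlonglongrightarrow> measure_pmf.expectation (ker u x) h" for x
      by (rule integral_dominated_convergence[where w = "\<lambda>_. 1"]) (use hN_lim hN in auto)
    then show "AE x in M. (\<lambda>N. F x * measure_pmf.expectation (ker u x) (hN N))
        \<longlonglongrightarrow> F x * measure_pmf.expectation (ker u x) h"
      by (intro AE_I2 tendsto_intros)
    show "AE x in M. norm (F x * measure_pmf.expectation (ker u x) (hN N)) \<le> 1" for N
      unfolding real_norm_def by (intro AE_I2 bF pmf_expectation_bound hN)
    show "(\<lambda>x. F x * measure_pmf.expectation (ker u x) h) \<in> borel_measurable M"
      using h by (intro borel_measurable_times meas) auto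
    show "(\<lambda>x. F x * measure_pmf.expectation (ker u x) (hN N)) \<in> borel_measurable M" for N
      using hN by (intro borel_measurable_times meas) auto
  qed auto
  ultimately show "(\<integral>x. F x * h (x u) \<partial>M) = (\<integral>x. F x * measure_pmf.expectation (ker u x) h \<partial>M)"
    unfolding eqN by (rule LIMSEQ_unique)
qed (use M coord in auto)

text \<open>Testing the conditional probability against products of past coordinates gives the chain
  identity. Conversely these tests include the cylinder indicators, which generate the past. The
  assumption \<open>kernel\<close> concerns states in \<open>G\<close> only, since paths never leave
  \<open>G\<close>.\<close>

lemma compatible_iff_chain:
  assumes kernel: "\<And>g w. g \<in> G \<Longrightarrow> (\<And>k. w k \<in> G) \<Longrightarrow> p g w = (\<integral>k. pmf (P k (w k)) g \<partial>\<theta>)"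
    and supp: "\<And>k i. set_pmf (P k i) \<subseteq> G"
  shows "compatible G p M \<longleftrightarrow> sets M = sets (path_space G) \<and> (\<forall>s t. chain M s t)"
proof (intro iffI conjI allI)
  fix s t
  assume comp: "compatible G p M"
  then have M: "prob_space M" "sets M = sets (path_space G)"
    and AE: "\<And>n g. g \<in> G \<Longrightarrow> AE x in M. real_cond_exp M (past_algebra G n) (indicator {y. y n = g}) x
                   = p g (\<lambda>k. x (n - int k))"
    by (auto simp: compatible_def)
  show "sets M = sets (path_space G)" by fact
  interpret prob_space M by fact
  have coord: "(\<lambda>x. x u) \<in> M \<rightarrow>\<^sub>M count_space UNIV" for u
    using coordinate_path_space M(2) by (simp cong: measurable_cong_sets)
  have sp: "space M = {x. \<forall>m. x m \<in> G}"
    using sets_eq_imp_space_eq[OF M(2)] by (simp add: space_path_space)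
  show "chain M s t"
  proof (rule chainI_indicator[OF M(1) coord])
    fix u F S g
    assume F: "prodf S F" "S \<subseteq> {..<u}"
    interpret finite_measure_subalgebra M "past_algebra G u"
      by unfold_locales (rule subalgebra_past[OF M(2)])
    have Fp: "F \<in> borel_measurable (past_algebra G u)"
      using F(2) by (intro prodf_measurable[OF F(1)] coordinate_past_algebra) auto
    show "(\<integral>x. F x * of_bool (x u = g) \<partial>M) = (\<integral>x. F x * pmf (ker u x) g \<partial>M)"
    proof (cases "g \<in> G")
      case True
      note [measurable] = coord
      have FM [measurable]: "F \<in> borel_measurable M" by (rule prodf_measurable[OF F(1)]) (rule coord)
      have Im [measurable]: "indicator {y. y u = g} \<in> borel_measurable M"
        unfolding indicator_def by measurable
      have "integrable M (\<lambda>x. F x * indicator {y. y u = g} x)"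
        by (rule integrable_const_bound[of _ 1]) (use prodf_bound[OF F(1)] in \<open>auto simp: indicator_def\<close>)
      note ce = real_cond_exp_intg[OF this Fp Im]
      have "(\<integral>x. F x * of_bool (x u = g) \<partial>M) = (\<integral>x. F x * indicator {y. y u = g} x \<partial>M)"
        by (intro Bochner_Integration.integral_cong) (auto simp: indicator_def)
      also have "\<dots> = (\<integral>x. F x * real_cond_exp M (past_algebra G u) (indicator {y. y u = g}) x \<partial>M)"
        using ce(2) by simp
      also have "\<dots> = (\<integral>x. F x * pmf (ker u x) g \<partial>M)"
      proof (rule integral_cong_AE)
        show "(\<lambda>x. F x * pmf (ker u x) g) \<in> borel_measurable M"
          by (intro borel_measurable_times FM measurable_pmf_ker coord)
        show "AE x in M. F x * real_cond_exp M (past_algebra G u) (indicator {y. y u = g}) x = F x * pmf (ker u x) g"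
          using AE[OF True, of u] AE_space
          by eventually_elim (auto simp: sp pmf_ker kernel True)
      qed (use ce(1) in auto)
      finally show ?thesis .
    next
      \<comment> \<open>\<open>compatible\<close> is silent about states outside \<open>G\<close>;
        there both sides vanish, as path and kernel stay in \<open>G\<close>.\<close>
      case False
      have "pmf (ker u x) g = 0" for x
        using False supp by (auto simp: pmf_eq_0_set_pmf ker_def)
      moreover have "(\<integral>x. F x * of_bool (x u = g) \<partial>M) = (\<integral>x. 0 \<partial>M)"
        using False by (intro Bochner_Integration.integral_cong) (auto simp: sp)
      ultimately show ?thesis by simp
    qed
  qed
next
  assume *: "sets M = sets (path_space G) \<and> (\<forall>s t. chain M s t)"
  then have M: "prob_space M" "sets M = sets (path_space G)" and chain: "\<And>s t. chain M s t"
    by (auto simp: chain_def)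
  interpret prob_space M by fact
  have coord [measurable]: "(\<lambda>x. x u) \<in> M \<rightarrow>\<^sub>M count_space UNIV" for u
    using coordinate_path_space M(2) by (simp cong: measurable_cong_sets)
  have sp: "space M = {x. \<forall>m. x m \<in> G}"
    using sets_eq_imp_space_eq[OF M(2)] by (simp add: space_path_space)
  show "compatible G p M"
    unfolding compatible_def
  proof (intro conjI allI ballI)
    fix n g
    assume g: "g \<in> G"
    interpret finite_measure_subalgebra M "past_algebra G n"
      by unfold_locales (rule subalgebra_past[OF M(2)])
    let ?f = "indicator {y. y n = g} :: (int \<Rightarrow> nat) \<Rightarrow> real"
    let ?q = "\<lambda>x. pmf (ker n x) g"
    \<comment> \<open>Jumps are positive, so the kernel at \<open>n\<close> reads only sites
      strictly before \<open>n\<close>.\<close>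
    have q_past: "?q \<in> borel_measurable (past_algebra G n)"
    proof (rule measurable_pmf_ker)
      fix k assume "k \<in> set_pmf \<theta>"
      then have "0 < k" using pos by (auto intro!: gr0I)
      then show "(\<lambda>x. x (n - int k)) \<in> past_algebra G n \<rightarrow>\<^sub>M count_space UNIV"
        by (intro coordinate_past_algebra) auto
    qed
    have q_M [measurable]: "?q \<in> borel_measurable M" by (rule measurable_from_subalg[OF subalg q_past])
    have f_M [measurable]: "?f \<in> borel_measurable M"
      unfolding indicator_def by measurable
    have int: "integrable M ?f" "integrable M ?q"
      by (rule integrable_const_bound[of _ 1]; auto simp: indicator_def pmf_le_1)+
    have sets_cyl: "A \<in> sets M" if "A \<in> sigma_sets (space (path_space G)) (cylinders G n)" for A
    proof -
      have "cylinders G n \<subseteq> sets M"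
      proof
        fix A assume "A \<in> cylinders G n"
        then obtain S Y where A: "A = {x \<in> space (path_space G). \<forall>s\<in>S. x s \<in> Y s}" "finite S"
          unfolding cylinders_def by blast
        have [measurable]: "Measurable.pred M (\<lambda>x. x s \<in> Y s)" for s
          by (rule measurable_compose[OF coord]) auto
        have "{x \<in> space M. \<forall>s\<in>S. x s \<in> Y s} \<in> sets M" using A(2) by measurable
        then show "A \<in> sets M" using A(1) sets_eq_imp_space_eq[OF M(2)] by simp
      qed
      then show ?thesis
        using that sets.sigma_sets_subset[of "cylinders G n" M] sets_eq_imp_space_eq[OF M(2)] by auto
    qed
    have si: "set_integrable M B ?f" "set_integrable M B ?q" if "B \<in> sets M" for B
      unfolding set_integrable_def using that int by (auto intro!: integrable_mult_indicator simp del: real_scaleR_def)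
    have cyl: "(\<integral>x\<in>A. ?f x \<partial>M) = (\<integral>x\<in>A. ?q x \<partial>M)" if A_cyl: "A \<in> cylinders G n" for A
    proof -
      obtain S Y where A: "A = {x \<in> space (path_space G). \<forall>s\<in>S. x s \<in> Y s}" "finite S" "S \<subseteq> {..<n}"
        using A_cyl unfolding cylinders_def by blast
      let ?F = "\<lambda>x. of_bool (\<forall>s\<in>S. x s \<in> Y s) :: real"
      have "(\<integral>x\<in>A. ?f x \<partial>M) = (\<integral>x. ?F x * of_bool (x n = g) \<partial>M)"
        unfolding set_lebesgue_integral_def A
        by (intro Bochner_Integration.integral_cong)
           (auto simp: indicator_def sets_eq_imp_space_eq[OF M(2)])
      also have "\<dots> = (\<integral>x. ?F x * measure_pmf.expectation (ker n x) (\<lambda>i. of_bool (i = g)) \<partial>M)"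
        by (rule chain[of "n - 1" n, unfolded chain_iff_ker, THEN conjunct2, THEN conjunct2, rule_format])
           (use prodf_cylinder[OF A(2), of Y] A(3) in auto)
      also have "(\<lambda>i. of_bool (i = g) :: real) = indicator {g}" by (auto simp: indicator_def)
      also have "(\<integral>x. ?F x * measure_pmf.expectation (ker n x) (indicat_real {g}) \<partial>M) = (\<integral>x. ?F x * ?q x \<partial>M)"
        by (simp add: measure_pmf_single)
      also have "\<dots> = (\<integral>x\<in>A. ?q x \<partial>M)"
        unfolding set_lebesgue_integral_def A
        by (intro Bochner_Integration.integral_cong)
           (auto simp: indicator_def sets_eq_imp_space_eq[OF M(2)])
      finally show ?thesis .
    qed
    \<comment> \<open>Dynkin argument: sets with equal integrals are closed under complements and
      countable disjoint unions, and the cylinders are closed under intersection.\<close>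
    have "(\<integral>x\<in>A. ?f x \<partial>M) = (\<integral>x\<in>A. ?q x \<partial>M)" if "A \<in> sets (past_algebra G n)" for A
    proof -
      have "cylinders G n \<subseteq> Pow (space (path_space G))" by (auto simp: cylinders_def)
      moreover have "A \<in> sigma_sets (space (path_space G)) (cylinders G n)"
        using that sets_past_algebra_cylinders by blast
      ultimately show ?thesis
      proof (induction rule: sigma_sets_induct_disjoint[OF Int_stable_cylinders, consumes 2])
        case (1 A)
        then show ?case by (rule cyl)
      next
        case 2
        show ?case by (simp add: set_lebesgue_integral_def)
      next
        case (3 A)
        let ?\<Omega> = "space (path_space G)"
        have A: "A \<in> sets M" "A \<subseteq> ?\<Omega>" "?\<Omega> \<in> sets M"
          using sets_cyl[OF 3(1)] sets.sets_into_space[of A "path_space G"] M(2) by auto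
        then have B: "?\<Omega> - A \<in> sets M" and U: "A \<union> (?\<Omega> - A) = ?\<Omega>" by auto
        \<comment> \<open>The whole space is the cylinder without constraints, so complements follow
          by additivity.\<close>
        have "?\<Omega> \<in> cylinders G n"
          unfolding cylinders_def by (intro CollectI exI[of _ "{}"]) auto
        from cyl[OF this] have "(\<integral>x\<in>A \<union> (?\<Omega> - A). ?f x \<partial>M) = (\<integral>x\<in>A \<union> (?\<Omega> - A). ?q x \<partial>M)"
          unfolding U .
        then have "(\<integral>x\<in>A. ?f x \<partial>M) + (\<integral>x\<in>?\<Omega> - A. ?f x \<partial>M) = (\<integral>x\<in>A. ?q x \<partial>M) + (\<integral>x\<in>?\<Omega> - A. ?q x \<partial>M)"
          using A B by (subst (asm) (1 2) set_integral_Un) (auto intro: si)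
        then show ?case using 3 by simp
      next
        case (4 A)
        have A: "A i \<in> sets M" for i using 4(2) by (intro sets_cyl) auto
        then have "(\<Union>i. A i) \<in> sets M" by auto
        then show ?case
          using lebesgue_integral_countable_add[of A M ?f] lebesgue_integral_countable_add[of A M ?q] A 4(1,3) si
          by (simp add: disjoint_family_on_def)
      qed
    qed
    then have "AE x in M. real_cond_exp M (past_algebra G n) ?f x = ?q x"
      by (rule real_cond_exp_charact[OF _ int q_past])
    with AE_space show "AE x in M. real_cond_exp M (past_algebra G n) ?f x = p g (\<lambda>k. x (n - int k))"
      by eventually_elim (auto simp: sp pmf_ker kernel g)
  qed (use M in auto)
qed

end

section \<open>Existence and uniqueness\<close>

lemma nn_integral_has_sum:
  assumes "(f has_sum s) A" "\<And>x. x \<in> A \<Longrightarrow> (0::real) \<le> f x"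
  shows "(\<integral>\<^sup>+x. f x \<partial>count_space A) = ennreal s"
proof -
  have "Infinite_Sum.abs_summable_on f A"
    using assms has_sum_imp_summable summable_on_iff_abs_summable_on_real by blast
  then have abs: "Infinite_Set_Sum.abs_summable_on f A"
    by (rule abs_summable_equivalent[THEN iffD1])
  then have "(\<integral>\<^sup>+x. f x \<partial>count_space A) = ennreal (infsetsum f A)"
    using assms(2) by (rule nn_integral_conv_infsetsum)
  also have "infsetsum f A = s"
    using infsetsum_infsum[OF abs] infsumI[OF assms(1)] by simp
  finally show ?thesis .
qed

lemma pmf_exists:
  assumes "(f has_sum (1::real)) A" "\<And>x. x \<in> A \<Longrightarrow> 0 \<le> f x"
  obtains p where "\<And>x. pmf p x = (if x \<in> A then f x else 0)"
proof -
  let ?f = "\<lambda>x. if x \<in> A then f x else 0"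
  have "(\<integral>\<^sup>+x. ?f x \<partial>count_space UNIV) = (\<integral>\<^sup>+x. f x \<partial>count_space A)"
    by (subst nn_integral_count_space_indicator[of A]) (auto intro!: nn_integral_cong simp: indicator_def)
  also have "\<dots> = 1" using nn_integral_has_sum[OF assms] by simp
  finally have "pmf (embed_pmf ?f) x = ?f x" for x
    using assms(2) by (intro pmf_embed_pmf) auto
  then show ?thesis using that by blast
qed

lemma pmf_expectation_finite_approx:
  fixes F :: "'a \<Rightarrow> real"
  assumes "finite K" and F: "\<And>y. \<bar>F y\<bar> \<le> C"
  shows "\<bar>measure_pmf.expectation p F - (\<Sum>y\<in>K. F y * pmf p y)\<bar> \<le> C * measure p (- K)"
proof -
  have int: "integrable p F" "integrable p (\<lambda>y. F y * indicator K y)" "integrable p (indicat_real (- K))"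
    "integrable p (\<lambda>y. F y * indicator (- K) y)"
    by (rule measure_pmf.integrable_const_bound[of _ "max 1 C"];
        use F in \<open>auto simp: indicator_def intro!: AE_I2 intro: max.coboundedI2 order_trans[OF abs_ge_zero]\<close>)+
  have "(\<Sum>y\<in>K. F y * pmf p y) = (\<Sum>y\<in>K. F y * indicator K y * pmf p y)"
    by (intro sum.cong) (auto simp: indicator_def)
  also have "\<dots> = measure_pmf.expectation p (\<lambda>y. F y * indicator K y)"
    using assms(1) by (intro integral_measure_pmf_real[symmetric]) (auto simp: indicator_def split: if_splits)
  finally have "measure_pmf.expectation p F - (\<Sum>y\<in>K. F y * pmf p y)
      = measure_pmf.expectation p (\<lambda>y. F y - F y * indicator K y)"
    using int by simp
  also have "(\<lambda>y. F y - F y * indicator K y) = (\<lambda>y. F y * indicator (- K) y)"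
    by (auto simp: indicator_def)
  also have "\<bar>measure_pmf.expectation p \<dots>\<bar> \<le> measure_pmf.expectation p (\<lambda>y. \<bar>F y * indicator (- K) y\<bar>)"
    by (rule integral_abs_bound)
  also have "\<dots> \<le> measure_pmf.expectation p (\<lambda>y. C * indicator (- K) y)"
    by (rule integral_mono[OF integrable_abs[OF int(4)] integrable_mult_right[OF int(3)]])
       (use F in \<open>auto simp: indicator_def\<close>)
  also have "\<dots> = C * measure p (- K)" by simp
  finally show ?thesis .
qed

text \<open>A pointwise limit of pmfs may lose mass. Tightness excludes this, and it then reduces
  the comparison of expectations to a finite set.\<close>

lemma pmf_limit:
  fixes p :: "nat \<Rightarrow> 'a pmf"
  assumes conv: "\<And>y. convergent (\<lambda>n. pmf (p n) y)"
    and tight: "\<And>e. 0 < e \<Longrightarrow> \<exists>K. finite K \<and> eventually (\<lambda>n. measure (p n) (- K) \<le> e) sequentially"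
  obtains q where "\<And>F C. (\<And>y. \<bar>F y\<bar> \<le> C) \<Longrightarrow>
    (\<lambda>n. measure_pmf.expectation (p n) F) \<longlonglongrightarrow> (measure_pmf.expectation q F :: real)"
proof -
  define f where "f y = lim (\<lambda>n. pmf (p n) y)" for y
  have f: "(\<lambda>n. pmf (p n) y) \<longlonglongrightarrow> f y" for y
    using conv unfolding f_def by (simp add: convergent_LIMSEQ_iff)
  have f0: "0 \<le> f y" for y by (rule LIMSEQ_le_const[OF f]) auto
  have sumK: "(\<lambda>n. measure (p n) K) \<longlonglongrightarrow> sum f K" if "finite K" for K
    unfolding measure_measure_pmf_finite[OF that] by (intro tendsto_sum f)
  have le1: "sum f K \<le> 1" if "finite K" for K
    by (rule LIMSEQ_le_const2[OF sumK[OF that]]) auto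
  have compl: "measure (p n) (- K) = 1 - measure (p n) K" for n K
    using measure_pmf.prob_compl[of K "p n"] by (simp add: Compl_eq_Diff_UNIV)
  have ge: "1 - e \<le> sum f K" if K: "finite K" "eventually (\<lambda>n. measure (p n) (- K) \<le> e) sequentially" for K e
  proof (rule tendsto_lowerbound[OF sumK[OF K(1)]])
    show "\<forall>\<^sub>F n in sequentially. 1 - e \<le> measure (p n) K"
      using K(2) by eventually_elim (simp add: compl)
  qed auto
  have "(f has_sum 1) UNIV"
    unfolding has_sum_def
  proof (rule tendstoI)
    fix e :: real assume e: "0 < e"
    obtain K where K: "finite K" "eventually (\<lambda>n. measure (p n) (- K) \<le> e / 2) sequentially"
      using tight[of "e / 2"] e by auto
    show "\<forall>\<^sub>F X in finite_subsets_at_top UNIV. dist (sum f X) 1 < e"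
      unfolding eventually_finite_subsets_at_top
    proof (intro exI[of _ K] conjI allI impI)
      fix X assume X: "finite X \<and> K \<subseteq> X \<and> X \<subseteq> UNIV"
      then have "sum f K \<le> sum f X" using f0 by (intro sum_mono2) auto
      then show "dist (sum f X) 1 < e"
        using le1[of X] ge[OF K] X e by (auto simp: dist_real_def)
    qed (use K in auto)
  qed
  then obtain q where q: "pmf q y = f y" for y
    using f0 pmf_exists[of f UNIV] by auto
  have "(\<lambda>n. measure_pmf.expectation (p n) F) \<longlonglongrightarrow> measure_pmf.expectation q F"
    if F: "\<And>y. \<bar>F y\<bar> \<le> C" for F :: "'a \<Rightarrow> real" and C
  proof (rule tendstoI)
    fix r :: real assume r: "0 < r"
    have C: "0 \<le> C" by (rule order_trans[OF abs_ge_zero F])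
    \<comment> \<open>Two truncation errors \<open>C * e\<close> and one pointwise error below
      \<open>e\<close> must stay under \<open>r\<close>; the summand 2 also keeps the denominator
      positive when \<open>C = 0\<close>.\<close>
    define e where "e = r / (2 * C + 2)"
    have e: "0 < e" using r C by (simp add: e_def)
    obtain K where K: "finite K" "eventually (\<lambda>n. measure (p n) (- K) \<le> e) sequentially"
      using tight[OF e] by blast
    have "measure q (- K) = 1 - sum f K"
      using measure_pmf.prob_compl[of K q] by (simp add: Compl_eq_Diff_UNIV measure_measure_pmf_finite[OF K(1)] q)
    then have qK: "measure q (- K) \<le> e" using ge[OF K] by simp
    have "(\<lambda>n. \<Sum>y\<in>K. F y * pmf (p n) y) \<longlonglongrightarrow> (\<Sum>y\<in>K. F y * f y)"
      by (intro tendsto_intros f)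
    then have "eventually (\<lambda>n. \<bar>(\<Sum>y\<in>K. F y * pmf (p n) y) - (\<Sum>y\<in>K. F y * f y)\<bar> < e) sequentially"
      using e by (auto dest!: tendstoD simp: dist_real_def)
    with K(2) show "eventually (\<lambda>n. dist (measure_pmf.expectation (p n) F) (measure_pmf.expectation q F) < r) sequentially"
    proof eventually_elim
      case (elim n)
      have "\<bar>measure_pmf.expectation (p n) F - (\<Sum>y\<in>K. F y * pmf (p n) y)\<bar> \<le> C * e"
        using pmf_expectation_finite_approx[where F = F and C = C and p = "p n", OF K(1) F] mult_left_mono[OF elim(1) C] by linarith
      moreover have "\<bar>measure_pmf.expectation q F - (\<Sum>y\<in>K. F y * f y)\<bar> \<le> C * e"
        using pmf_expectation_finite_approx[where F = F and C = C and p = q, OF K(1) F] mult_left_mono[OF qK C] unfolding q by linarith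
      moreover have "C * e + C * e + e < r"
      proof -
        have "(2 * C + 2) * e = r" using C by (simp add: e_def)
        then have "C * e + C * e + e + e = r" by (simp add: algebra_simps)
        then show ?thesis using e by linarith
      qed
      ultimately show ?case using elim(2) unfolding dist_real_def by linarith
    qed
  qed
  then show ?thesis using that by blast
qed

lemma prodf_cong: "prodf S F \<Longrightarrow> (\<And>s. s \<in> S \<Longrightarrow> x s = y s) \<Longrightarrow> F x = F y"
  by (induction rule: prodf.induct) auto

section \<open>Processes started from a constant past\<close>

context imitation
begin

lemma chain_mono: "chain M s t \<Longrightarrow> s \<le> s' \<Longrightarrow> t' \<le> t \<Longrightarrow> chain M s' t'"
  unfolding chain_def by (elim conjE, intro conjI allI impI) auto

lemma ker_upd: "u \<le> v \<Longrightarrow> ker u (x(v := g)) = ker u x"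
  unfolding ker_def
proof (rule bind_pmf_cong)
  fix k assume "u \<le> v" "k \<in> set_pmf \<theta>"
  then have "0 < k" using pos by (auto intro!: gr0I)
  then show "P k ((x(v := g)) (u - int k)) = P k (x (u - int k))" using \<open>u \<le> v\<close> by auto
qed simp

text \<open>The first \<open>n\<close> steps after time \<open>s\<close> of the process with constant past 1; later coordinates keep the
  dummy value 1.\<close>

primrec traj :: "int \<Rightarrow> nat \<Rightarrow> (int \<Rightarrow> nat) pmf" where
  "traj s 0 = return_pmf (\<lambda>_. 1)"
| "traj s (Suc n) = bind_pmf (traj s n)
     (\<lambda>x. map_pmf (\<lambda>g. x(s + int (Suc n) := g)) (ker (s + int (Suc n)) x))"

lemma traj_Suc_expectation:
  fixes Q :: "(int \<Rightarrow> nat) \<Rightarrow> real"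
  assumes "\<And>x. \<bar>Q x\<bar> \<le> C"
  shows "measure_pmf.expectation (traj s (Suc n)) Q
    = (\<integral>x. (\<integral>g. Q (x(s + int (Suc n) := g)) \<partial>ker (s + int (Suc n)) x) \<partial>traj s n)"
  unfolding traj.simps by (subst pmf_expectation_bind[OF assms]) simp

text \<open>Later steps only write sites above \<open>s + m\<close>, which \<open>Q\<close>
  ignores.\<close>

lemma traj_stable:
  fixes Q :: "(int \<Rightarrow> nat) \<Rightarrow> real"
  assumes Q: "\<And>x. \<bar>Q x\<bar> \<le> C" "\<And>x v g. s + int m < v \<Longrightarrow> Q (x(v := g)) = Q x" and "m \<le> n"
  shows "measure_pmf.expectation (traj s n) Q = measure_pmf.expectation (traj s m) Q"
  using \<open>m \<le> n\<close>
proof (induction n rule: dec_induct)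
  case (step n)
  then show ?case by (subst traj_Suc_expectation[OF Q(1)]) (simp add: Q(2))
qed simp

text \<open>The identity is pulled back to the step that writes \<open>u\<close>: its left side
  ignores all later steps, and its right side ignores that step too.\<close>

lemma chain_traj: "chain (measure_pmf (traj s n)) s (s + int n)"
  unfolding chain_iff_ker
proof (intro conjI allI impI)
  fix u F S and h :: "nat \<Rightarrow> real"
  assume u: "s < u" "u \<le> s + int n" and F: "prodf S F" "S \<subseteq> {..<u}" and h: "\<forall>i. \<bar>h i\<bar> \<le> 1"
  define m where "m = nat (u - s - 1)"
  have m: "u = s + int (Suc m)" "Suc m \<le> n" "m \<le> n" using u by (auto simp: m_def)
  have F_upd: "F (x(v := g)) = F x" if "u \<le> v" for x v g
    using F(2) that by (intro prodf_cong[OF F(1)]) auto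
  have bF: "\<bar>F x * y\<bar> \<le> 1" if "\<bar>y\<bar> \<le> 1" for x y
    unfolding abs_mult using that by (intro mult_le_one prodf_bound[OF F(1)]) auto
  have "(\<integral>x. F x * h (x u) \<partial>traj s n) = (\<integral>x. F x * h (x u) \<partial>traj s (Suc m))"
    by (rule traj_stable[OF _ _ m(2), of _ 1]) (use h bF m(1) F_upd in auto)
  also have "\<dots> = (\<integral>x. (\<integral>g. F (x(u := g)) * h ((x(u := g)) u) \<partial>ker u x) \<partial>traj s m)"
    unfolding m(1) by (rule traj_Suc_expectation[of _ 1]) (use h bF in auto)
  also have "\<dots> = (\<integral>x. F x * measure_pmf.expectation (ker u x) h \<partial>traj s m)"
    by (simp add: F_upd)
  also have "\<dots> = (\<integral>x. F x * measure_pmf.expectation (ker u x) h \<partial>traj s n)"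
  proof (rule traj_stable[OF _ _ m(3), of _ 1, symmetric])
    show "\<bar>F x * measure_pmf.expectation (ker u x) h\<bar> \<le> 1" for x
      using h by (intro bF pmf_expectation_bound) auto
    show "F (x(v := g)) * measure_pmf.expectation (ker u (x(v := g))) h = F x * measure_pmf.expectation (ker u x) h"
      if "s + int m < v" for x v g
      using that m(1) by (simp add: F_upd ker_upd)
  qed
  finally show "(\<integral>x. F x * h (x u) \<partial>traj s n) = (\<integral>x. F x * measure_pmf.expectation (ker u x) h \<partial>traj s n)" .
qed (auto intro: prob_space_measure_pmf)

lemma traj_support:
  assumes "\<And>k i. set_pmf (P k i) \<subseteq> G" "1 \<in> G"
  shows "x \<in> set_pmf (traj s n) \<Longrightarrow> x u \<in> G"
proof (induction n arbitrary: x)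
  case (Suc n)
  then obtain x' g where x': "x' \<in> set_pmf (traj s n)" "x = x'(s + int (Suc n) := g)"
    and "g \<in> set_pmf (ker (s + int (Suc n)) x')"
    unfolding traj.simps by auto
  then have "g \<in> G" using assms(1) unfolding ker_def by auto
  then show ?case using Suc.IH[OF x'(1)] x'(2) by simp
qed (use assms in auto)

text \<open>Symmetric windows exhaust the integers, and their start recedes from every fixed finite
  set, as \<open>near\<close> requires.\<close>

definition traj_sym :: "nat \<Rightarrow> (int \<Rightarrow> nat) pmf" where
  "traj_sym N = traj (- int N) (2 * N)"

lemma chain_traj_sym: "int N0 \<le> int N \<Longrightarrow> chain (measure_pmf (traj_sym N)) (- int N0) (int N0)"
  using chain_traj[of "- int N" "2 * N"] unfolding traj_sym_def
  by (auto elim!: chain_mono)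

end

section \<open>Limits of the started processes and Kolmogorov extension\<close>

context doeblin
begin

text \<open>Both laws are chains on the window of radius \<open>N0\<close>, whatever happens before
  it, and \<open>\<bar>L\<bar> + b\<close> is a radius that puts \<open>S\<close> at least
  \<open>L\<close> above the lower end.\<close>

lemma traj_sym_close:
  assumes "finite S" "0 < e"
  obtains N0 where "\<And>N N' F. N0 \<le> N \<Longrightarrow> N0 \<le> N' \<Longrightarrow> prodf S F \<Longrightarrow>
    \<bar>measure_pmf.expectation (traj_sym N) F - measure_pmf.expectation (traj_sym N') F\<bar> \<le> e"
proof -
  obtain L where L: "near (card S) L e" using mixing[OF assms(2)] by blast
  define b where "b = Max (insert 0 (abs ` S))"
  have b: "0 \<le> b" "\<And>s. s \<in> S \<Longrightarrow> \<bar>s\<bar> \<le> b"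
    unfolding b_def using assms(1) by (auto intro!: Max_ge)
  define N0 where "N0 = nat (\<bar>L\<bar> + b)"
  have N0: "int N0 = \<bar>L\<bar> + b" using b by (simp add: N0_def)
  have S: "S \<subseteq> {- int N0 + L..int N0}" unfolding N0 using b(2) by fastforce
  have "\<bar>measure_pmf.expectation (traj_sym N) F - measure_pmf.expectation (traj_sym N') F\<bar> \<le> e"
    if "N0 \<le> N" "N0 \<le> N'" "prodf S F" for N N' F
    using nearD[OF L chain_traj_sym chain_traj_sym that(3) order_refl S, of N N']
      nearD[OF L chain_traj_sym chain_traj_sym that(3) order_refl S, of N' N] that by simp
  then show ?thesis using that by blast
qed

lemma traj_sym_convergent:
  assumes "prodf S F"
  shows "convergent (\<lambda>N. measure_pmf.expectation (traj_sym N) F)"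
proof (rule Cauchy_convergent, rule metric_CauchyI)
  fix e :: real assume e: "0 < e"
  have "finite S" "0 < e / 2" using assms e prodf_finite by auto
  then obtain N0 where "\<And>N N'. N0 \<le> N \<Longrightarrow> N0 \<le> N' \<Longrightarrow>
      \<bar>measure_pmf.expectation (traj_sym N) F - measure_pmf.expectation (traj_sym N') F\<bar> \<le> e / 2"
    using assms by (metis traj_sym_close)
  then show "\<exists>M. \<forall>m\<ge>M. \<forall>n\<ge>M. dist (measure_pmf.expectation (traj_sym m) F) (measure_pmf.expectation (traj_sym n) F) < e"
    unfolding dist_real_def using e by (intro exI[of _ N0]) force
qed

text \<open>From \<open>N0\<close> on, every tail probability at \<open>s\<close> is within
  \<open>e / 2\<close> of the one for \<open>N0\<close>, which is small because it belongs to a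
  single pmf. Mixing thus supplies tightness even if the state space is infinite.\<close>

lemma traj_sym_tight:
  assumes "0 < e"
  obtains R N0 where "\<And>N. N0 \<le> N \<Longrightarrow> measure (traj_sym N) {x. R < x s} \<le> e"
proof -
  obtain N0 where N0: "\<And>N N' F. N0 \<le> N \<Longrightarrow> N0 \<le> N' \<Longrightarrow> prodf {s} F \<Longrightarrow>
    \<bar>measure_pmf.expectation (traj_sym N) F - measure_pmf.expectation (traj_sym N') F\<bar> \<le> e / 2"
    using assms by (rule_tac traj_sym_close[of "{s}" "e / 2"]) auto
  obtain R where R: "measure (map_pmf (\<lambda>x. x s) (traj_sym N0)) {R<..} \<le> e / 2"
    using assms by (rule_tac pmf_tail[of "e / 2" "map_pmf (\<lambda>x. x s) (traj_sym N0)"]) auto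
  have "measure (traj_sym N) {x. R < x s} \<le> e" if N: "N0 \<le> N" for N
  proof -
    have eq: "measure_pmf.expectation (traj_sym N) (\<lambda>x. of_bool (\<forall>i\<in>{s}. x i \<in> {R<..})) = measure (traj_sym N) {x. R < x s}" for N
    proof -
      have "(\<lambda>x. of_bool (\<forall>i\<in>{s}. x i \<in> {R<..})) = indicat_real {x. R < x s}" by (auto simp: indicator_def)
      then show ?thesis by simp
    qed
    have "measure (traj_sym N0) {x. R < x s} \<le> e / 2"
      using R by (simp add: vimage_def)
    moreover have "\<bar>measure (traj_sym N) {x. R < x s} - measure (traj_sym N0) {x. R < x s}\<bar> \<le> e / 2"
      using N0[OF N order_refl prodf_cylinder[of "{s}" "\<lambda>_. {R<..}"]] unfolding eq by simp
    ultimately show ?thesis by linarith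
  qed
  then show ?thesis using that by blast
qed

text \<open>Point masses of restricted paths are cylinder probabilities and hence converge;
  tightness is inherited from the single sites.\<close>

lemma fdd_exists:
  assumes S: "finite S"
  obtains q where "\<And>F C. (\<And>y. \<bar>F y\<bar> \<le> C) \<Longrightarrow>
    (\<lambda>N. measure_pmf.expectation (traj_sym N) (\<lambda>x. F (restrict x S))) \<longlonglongrightarrow> (measure_pmf.expectation q F :: real)"
proof -
  define p where "p N = map_pmf (\<lambda>x. restrict x S) (traj_sym N)" for N
  have "convergent (\<lambda>N. pmf (p N) y)" for y
  proof (cases "y \<in> extensional S")
    case True
    have "pmf (p N) y = measure_pmf.expectation (traj_sym N) (\<lambda>x. of_bool (\<forall>s\<in>S. x s \<in> {y s}))" for N
    proof -
      have "(\<lambda>x. restrict x S) -` {y} = {x. \<forall>s\<in>S. x s \<in> {y s}}"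
        using True by (auto simp: extensional_def restrict_def fun_eq_iff)
      moreover have "(\<lambda>x. of_bool (\<forall>s\<in>S. x s \<in> {y s})) = indicat_real {x. \<forall>s\<in>S. x s \<in> {y s}}"
        by (auto simp: indicator_def)
      ultimately show ?thesis unfolding p_def by (simp add: pmf_map)
    qed
    then show ?thesis using traj_sym_convergent[OF prodf_cylinder[OF S, of "\<lambda>s. {y s}"]] by simp
  next
    case False
    then have "pmf (p N) y = 0" for N unfolding p_def by (auto simp: pmf_eq_0_set_pmf)
    then show ?thesis by (simp add: convergent_const)
  qed
  moreover have "\<exists>K. finite K \<and> eventually (\<lambda>N. measure (p N) (- K) \<le> e) sequentially" if "0 < e" for e
  proof -
    \<comment> \<open>For a union bound over \<open>S\<close>; the summand 1 covers empty
      \<open>S\<close>.\<close>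
    define d where "d = e / (card S + 1)"
    have d: "0 < d" "card S * d \<le> e" using that by (auto simp: d_def field_simps)
    have "\<exists>R N0. \<forall>N\<ge>N0. measure (traj_sym N) {x. R < x s} \<le> d" for s
      by (metis traj_sym_tight[OF d(1)])
    then obtain R N0 where R: "\<And>s N. N0 s \<le> N \<Longrightarrow> measure (traj_sym N) {x. R s < x s} \<le> d" by metis
    let ?K = "PiE S (\<lambda>s. {..R s})"
    have "measure (p N) (- ?K) \<le> e" if N: "\<forall>s\<in>S. N0 s \<le> N" for N
    proof -
      have "measure (p N) (- ?K) = measure (traj_sym N) {x. restrict x S \<notin> ?K}"
        unfolding p_def by (simp add: vimage_def)
      also have "\<dots> \<le> measure (traj_sym N) (\<Union>s\<in>S. {x. R s < x s})"
        by (intro measure_pmf.finite_measure_mono) (auto simp: not_le)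
      also have "\<dots> \<le> (\<Sum>s\<in>S. measure (traj_sym N) {x. R s < x s})"
        using S by (intro measure_UNION_le) auto
      also have "\<dots> \<le> (\<Sum>s\<in>S. d)" using N by (intro sum_mono R) auto
      also have "\<dots> \<le> e" using d by simp
      finally show ?thesis .
    qed
    note bound = this
    have "eventually (\<lambda>N. \<forall>s\<in>S. N0 s \<le> N) sequentially"
      using S by (intro eventually_ball_finite) (auto intro: eventually_ge_at_top)
    then have "eventually (\<lambda>N. measure (p N) (- ?K) \<le> e) sequentially"
      by (rule eventually_mono) (rule bound)
    moreover have "finite ?K" using S by (intro finite_PiE) auto
    ultimately show ?thesis by blast
  qed
  ultimately obtain q where q: "\<And>F C. (\<And>y. \<bar>F y\<bar> \<le> C) \<Longrightarrow>
    (\<lambda>n. measure_pmf.expectation (p n) F) \<longlonglongrightarrow> (measure_pmf.expectation q F :: real)"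
    using pmf_limit[of p] by blast
  show ?thesis
  proof (rule that)
    fix F :: "(int \<Rightarrow> nat) \<Rightarrow> real" and C
    assume "\<And>y. \<bar>F y\<bar> \<le> C"
    from q[OF this] show "(\<lambda>N. measure_pmf.expectation (traj_sym N) (\<lambda>x. F (restrict x S)))
        \<longlonglongrightarrow> measure_pmf.expectation q F"
      unfolding p_def by simp
  qed
qed

definition fdd :: "int set \<Rightarrow> (int \<Rightarrow> nat) pmf" where
  "fdd S = (SOME q. \<forall>F C. (\<forall>y. \<bar>F y\<bar> \<le> C) \<longrightarrow>
    (\<lambda>N. measure_pmf.expectation (traj_sym N) (\<lambda>x. F (restrict x S))) \<longlonglongrightarrow> (measure_pmf.expectation q F :: real))"

lemma fdd:
  fixes F :: "(int \<Rightarrow> nat) \<Rightarrow> real"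
  assumes "finite S" "\<And>y. \<bar>F y\<bar> \<le> C"
  shows "(\<lambda>N. measure_pmf.expectation (traj_sym N) (\<lambda>x. F (restrict x S))) \<longlonglongrightarrow> measure_pmf.expectation (fdd S) F"
proof -
  have "\<exists>q. \<forall>F C. (\<forall>y. \<bar>F y\<bar> \<le> C) \<longrightarrow>
    (\<lambda>N. measure_pmf.expectation (traj_sym N) (\<lambda>x. F (restrict x S))) \<longlonglongrightarrow> (measure_pmf.expectation q F :: real)"
    using fdd_exists[OF assms(1)] by metis
  from someI_ex[OF this] show ?thesis unfolding fdd_def[symmetric] using assms(2) by blast
qed

text \<open>Both sides are limits of the same sequence, because restricting to \<open>H\<close> and
  then to \<open>J\<close> is restricting to \<open>J\<close>.\<close>

lemma fdd_projective:
  assumes "J \<subseteq> H" "finite H"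
  shows "map_pmf (\<lambda>x. restrict x J) (fdd H) = fdd J"
proof (rule pmf_eqI)
  fix y
  have J: "finite J" using assms finite_subset by blast
  have "(\<lambda>N. measure_pmf.expectation (traj_sym N) (\<lambda>x. indicat_real {z. restrict z J = y} (restrict x H)))
      \<longlonglongrightarrow> measure_pmf.expectation (fdd H) (indicat_real {z. restrict z J = y})"
    by (rule fdd[OF assms(2), of _ 1]) (auto simp: indicator_def)
  moreover have "(\<lambda>N. measure_pmf.expectation (traj_sym N) (\<lambda>x. indicat_real {y} (restrict x J)))
      \<longlonglongrightarrow> measure_pmf.expectation (fdd J) (indicat_real {y})"
    by (rule fdd[OF J, of _ 1]) (auto simp: indicator_def)
  moreover have "(\<lambda>x. indicat_real {z. restrict z J = y} (restrict x H)) = (\<lambda>x. indicat_real {y} (restrict x J))"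
    using assms(1) by (simp add: indicator_def Int_absorb1)
  ultimately have "measure_pmf.expectation (fdd H) (indicat_real {z. restrict z J = y})
      = measure_pmf.expectation (fdd J) (indicat_real {y})"
    by (metis LIMSEQ_unique)
  then show "pmf (map_pmf (\<lambda>x. restrict x J) (fdd H)) y = pmf (fdd J) y"
    by (simp add: pmf_map vimage_def measure_pmf_single)
qed

text \<open>The library's extension theorem needs a Polish state space, an instance that \<^typ>\<open>nat\<close> lacks,
  hence the embedding into \<^typ>\<open>real\<close>.\<close>

definition real_fdd :: "int set \<Rightarrow> (int \<Rightarrow> real) measure" where
  "real_fdd J = distr (fdd J) (PiM J (\<lambda>_. borel)) (\<lambda>y. \<lambda>j\<in>J. real (y j))"

lemma polish_projective_real_fdd: "polish_projective UNIV real_fdd"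
proof (intro polish_projective.intro projective_family.intro)
  fix J H :: "int set"
  assume JH: "J \<subseteq> H" "finite H"
  have m: "(\<lambda>y. \<lambda>j\<in>J. real (y j)) \<in> measure_pmf p \<rightarrow>\<^sub>M PiM J (\<lambda>_. borel)" for J p
    by (simp add: space_PiM)
  have "distr (real_fdd H) (PiM J (\<lambda>_. borel)) (\<lambda>f. restrict f J)
      = distr (fdd H) (PiM J (\<lambda>_. borel)) ((\<lambda>f. restrict f J) \<circ> (\<lambda>y. \<lambda>j\<in>H. real (y j)))"
    unfolding real_fdd_def using JH(1) by (intro distr_distr measurable_restrict_subset m)
  also have "(\<lambda>f. restrict f J) \<circ> (\<lambda>y. \<lambda>j\<in>H. real (y j)) = (\<lambda>y. \<lambda>j\<in>J. real (y j)) \<circ> (\<lambda>x. restrict x J)"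
    using JH(1) by (auto simp: fun_eq_iff)
  also have "distr (fdd H) (PiM J (\<lambda>_. borel)) \<dots>
      = distr (distr (fdd H) (count_space UNIV) (\<lambda>x. restrict x J)) (PiM J (\<lambda>_. borel)) (\<lambda>y. \<lambda>j\<in>J. real (y j))"
    by (rule distr_distr[symmetric]) (auto simp: space_PiM)
  also have "\<dots> = real_fdd J"
    unfolding real_fdd_def fdd_projective[OF JH, symmetric] map_pmf_rep_eq ..
  finally show "real_fdd J = distr (real_fdd H) (PiM J (\<lambda>_. borel)) (\<lambda>f. restrict f J)" ..
next
  fix J :: "int set"
  show "prob_space (real_fdd J)"
    unfolding real_fdd_def by (intro prob_space.prob_space_distr prob_space_measure_pmf) (simp add: space_PiM)
qed

lemma limit_exists:
  assumes supp: "\<And>k i. set_pmf (P k i) \<subseteq> G" and G: "1 \<in> G"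
  obtains M where "prob_space M" "sets M = sets (path_space G)"
    "\<And>S F. prodf S F \<Longrightarrow> (\<lambda>N. measure_pmf.expectation (traj_sym N) F) \<longlonglongrightarrow> (\<integral>x. F x \<partial>M)"
proof -
  interpret polish_projective UNIV real_fdd by (rule polish_projective_real_fdd)
  \<comment> \<open>The extension theorem yields arbitrary real paths. With the default 1 outside
    \<open>G\<close>, \<open>\<rho>\<close> turns each of them into a path in
    \<open>G\<close>.\<close>
  define r where "r i = (if i \<in> G then i else 1)" for i
  have rG: "r i \<in> G" for i using G by (simp add: r_def)
  define \<rho> where "\<rho> x n = r (nat \<lfloor>x n\<rfloor>)" for x :: "int \<Rightarrow> real" and n
  have sets_lim: "sets lim = sets (PiM UNIV (\<lambda>_. borel))" by simp
  have floor_m: "(\<lambda>a :: real. r (nat \<lfloor>a\<rfloor>)) \<in> borel \<rightarrow>\<^sub>M count_space G"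
    by (rule measurable_compose[where N = "count_space UNIV" and f = floor and g = "\<lambda>a. r (nat a)"])
       (auto simp: rG)
  have \<rho>_m: "\<rho> \<in> lim \<rightarrow>\<^sub>M path_space G"
    unfolding \<rho>_def path_space_def
  proof (rule measurable_PiM_single')
    show "(\<lambda>x. r (nat \<lfloor>x n\<rfloor>)) \<in> lim \<rightarrow>\<^sub>M count_space G" for n
      by (rule measurable_compose[OF _ floor_m])
         (simp add: measurable_cong_sets[OF sets_lim refl] measurable_component_singleton)
  qed (auto simp: rG)
  define M where "M = distr lim (path_space G) \<rho>"
  have M: "prob_space M" "sets M = sets (path_space G)"
    unfolding M_def by (auto intro!: P.prob_space_distr \<rho>_m)
  have "(\<lambda>N. measure_pmf.expectation (traj_sym N) F) \<longlonglongrightarrow> (\<integral>x. F x \<partial>M)" if F: "prodf S F" for S F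
  proof -
    have S: "finite S" using F by (rule prodf_finite)
    have res: "(\<lambda>x. restrict x S) \<in> lim \<rightarrow>\<^sub>M PiM S (\<lambda>_. borel)"
      unfolding measurable_cong_sets[OF sets_lim refl] by (rule measurable_restrict_subset) simp
    have lim_S: "distr lim (PiM S (\<lambda>_. borel)) (\<lambda>x. restrict x S) = real_fdd S"
    proof (rule measure_eqI)
      fix X assume "X \<in> sets (distr lim (PiM S (\<lambda>_. borel)) (\<lambda>x. restrict x S))"
      then have X: "X \<in> sets (PiM S (\<lambda>_. borel :: real measure))" by simp
      have "emeasure (distr lim (PiM S (\<lambda>_. borel)) (\<lambda>x. restrict x S)) X
          = emeasure lim ((\<lambda>x. restrict x S) -` X \<inter> space lim)"
        using X res by (intro emeasure_distr) auto
      also have "(\<lambda>x. restrict x S) -` X \<inter> space lim = prod_emb UNIV (\<lambda>_. borel) S X"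
        by (simp add: prod_emb_def space_PiM)
      also have "emeasure lim \<dots> = emeasure (real_fdd S) X"
        using S X by (intro emeasure_lim_emb) auto
      finally show "emeasure (distr lim (PiM S (\<lambda>_. borel)) (\<lambda>x. restrict x S)) X = emeasure (real_fdd S) X" .
    qed (simp add: real_fdd_def)
    have FM: "F \<in> borel_measurable (path_space G)"
      by (rule prodf_measurable[OF F]) (rule coordinate_path_space)
    have F\<rho>: "(\<lambda>z. F (\<rho> z)) \<in> borel_measurable (PiM S (\<lambda>_. borel))"
    proof (rule prodf_measurable_compose[OF F])
      fix s assume "s \<in> S"
      then have "(\<lambda>x. \<rho> x s) \<in> PiM S (\<lambda>_. borel) \<rightarrow>\<^sub>M count_space G"
        unfolding \<rho>_def by (intro measurable_compose[OF _ floor_m] measurable_component_singleton)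
      then show "(\<lambda>x. \<rho> x s) \<in> PiM S (\<lambda>_. borel) \<rightarrow>\<^sub>M count_space UNIV"
        by (rule measurable_compose) simp
    qed
    have "(\<integral>x. F x \<partial>M) = (\<integral>x. F (\<rho> x) \<partial>lim)"
      unfolding M_def by (rule integral_distr[OF \<rho>_m FM])
    also have "\<dots> = (\<integral>x. F (\<rho> (restrict x S)) \<partial>lim)"
      by (intro Bochner_Integration.integral_cong refl prodf_cong[OF F]) (auto simp: \<rho>_def)
    also have "\<dots> = (\<integral>z. F (\<rho> z) \<partial>real_fdd S)"
      unfolding lim_S[symmetric]
      by (rule integral_distr[OF res F\<rho>, symmetric])
    also have "\<dots> = (\<integral>y. F (\<rho> (\<lambda>j\<in>S. real (y j))) \<partial>fdd S)"
      unfolding real_fdd_def by (rule integral_distr) (auto simp: F\<rho> space_PiM)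
    also have "\<dots> = (\<integral>y. F (\<lambda>n. r (y n)) \<partial>fdd S)"
      by (intro Bochner_Integration.integral_cong refl prodf_cong[OF F]) (auto simp: \<rho>_def)
    finally have eq: "(\<integral>x. F x \<partial>M) = (\<integral>y. F (\<lambda>n. r (y n)) \<partial>fdd S)" .
    have "(\<lambda>N. measure_pmf.expectation (traj_sym N) (\<lambda>x. F (\<lambda>n. r (restrict x S n)))) \<longlonglongrightarrow> (\<integral>y. F (\<lambda>n. r (y n)) \<partial>fdd S)"
      by (rule fdd[OF S]) (rule prodf_bound[OF F])
    \<comment> \<open>The started processes stay in \<open>G\<close>, where \<open>r\<close> is the
      identity.\<close>
    moreover have "measure_pmf.expectation (traj_sym N) (\<lambda>x. F (\<lambda>n. r (restrict x S n)))
        = measure_pmf.expectation (traj_sym N) F" for N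
      unfolding traj_sym_def
      by (intro integral_cong_AE)
         (auto simp: AE_measure_pmf_iff r_def traj_support[OF supp G] intro!: prodf_cong[OF F])
    ultimately show ?thesis unfolding eq by simp
  qed
  then show ?thesis using that M by blast
qed

text \<open>The chain identity holds for \<open>traj_sym N\<close> once \<open>N\<close> exceeds
  \<open>\<bar>u\<bar>\<close>, and it survives the limit: for each jump the inner integral
  converges, and dominated convergence handles the sum over jumps.\<close>

lemma chain_exists:
  assumes supp: "\<And>k i. set_pmf (P k i) \<subseteq> G" and G: "1 \<in> G"
  obtains M where "sets M = sets (path_space G)" "\<And>s t. chain M s t"
proof -
  obtain M where M: "prob_space M" "sets M = sets (path_space G)"
    and lim: "\<And>S F. prodf S F \<Longrightarrow> (\<lambda>N. measure_pmf.expectation (traj_sym N) F) \<longlonglongrightarrow> (\<integral>x. F x \<partial>M)"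
    using limit_exists[OF assms] by blast
  have "chain M s t" for s t
    unfolding chain_def
  proof (intro conjI allI impI)
    fix u F S and h :: "nat \<Rightarrow> real"
    assume F: "prodf S F" "S \<subseteq> {..<u}" and h: "\<forall>i. \<bar>h i\<bar> \<le> 1"
    have pr: "prodf (insert (u - int k) S) (\<lambda>x. F x * lift k h (x (u - int k)))" for k
      using h by (intro prodf_lift[OF F(1)]) auto
    have "prodf (insert u S) (\<lambda>x. F x * h (x u))"
      using h by (intro prodf.mult[OF F(1)]) auto
    then have lim1: "(\<lambda>N. \<integral>x. F x * h (x u) \<partial>traj_sym N) \<longlonglongrightarrow> (\<integral>x. F x * h (x u) \<partial>M)" by (rule lim)
    have lim2: "(\<lambda>N. \<integral>k. (\<integral>x. F x * lift k h (x (u - int k)) \<partial>traj_sym N) \<partial>\<theta>)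
        \<longlonglongrightarrow> (\<integral>k. (\<integral>x. F x * lift k h (x (u - int k)) \<partial>M) \<partial>\<theta>)"
    proof (rule integral_dominated_convergence[where w = "\<lambda>_. 1"])
      show "AE k in \<theta>. (\<lambda>N. \<integral>x. F x * lift k h (x (u - int k)) \<partial>traj_sym N)
          \<longlonglongrightarrow> (\<integral>x. F x * lift k h (x (u - int k)) \<partial>M)"
        by (rule AE_I2) (rule lim[OF pr])
      show "AE k in \<theta>. norm (\<integral>x. F x * lift k h (x (u - int k)) \<partial>traj_sym N) \<le> 1" for N
        unfolding real_norm_def by (intro AE_I2 pmf_expectation_bound prodf_bound[OF pr])
    qed auto
    have "eventually (\<lambda>N. (\<integral>x. F x * h (x u) \<partial>traj_sym N)
        = (\<integral>k. (\<integral>x. F x * lift k h (x (u - int k)) \<partial>traj_sym N) \<partial>\<theta>)) sequentially"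
      using eventually_gt_at_top[of "nat \<bar>u\<bar>"]
    proof eventually_elim
      case (elim N)
      then show ?case
        using chain_traj_sym[of N N] F h unfolding chain_def by auto
    qed
    from Lim_transform_eventually[OF lim1 this] lim2
    show "(\<integral>x. F x * h (x u) \<partial>M) = (\<integral>k. (\<integral>x. F x * lift k h (x (u - int k)) \<partial>M) \<partial>\<theta>)"
      by (rule LIMSEQ_unique)
  qed (use M coordinate_path_space in \<open>auto cong: measurable_cong_sets\<close>)
  then show ?thesis using that M(2) by blast
qed

text \<open>Both laws are chains on every window, so its lower end can be moved as far below
  \<open>S\<close> as any given error demands. All cylinder probabilities therefore agree.\<close>

lemma chain_unique:
  assumes M: "sets M = sets (path_space G)" "\<And>s t. chain M s t"
    and N: "sets N = sets (path_space G)" "\<And>s t. chain N s t"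
  shows "M = N"
proof -
  have eq: "(\<integral>x. F x \<partial>M) = (\<integral>x. F x \<partial>N)" if F: "prodf S F" for S F
  proof -
    have finS: "finite S" using F by (rule prodf_finite)
    have "\<bar>(\<integral>x. F x \<partial>M) - (\<integral>x. F x \<partial>N)\<bar> \<le> e" if e: "0 < e" for e
    proof -
      obtain L where L: "near (card S) L e" using mixing[OF e] by blast
      \<comment> \<open>Inserting 0 keeps \<open>Min\<close> and \<open>Max\<close> meaningful for
        empty \<open>S\<close>.\<close>
      define s t where "s = Min (insert 0 S) - L" and "t = Max (insert 0 S)"
      have S: "S \<subseteq> {s + L..t}" using finS by (auto simp: s_def t_def)
      show ?thesis
        using nearD[OF L M(2) N(2) F order_refl S] nearD[OF L N(2) M(2) F order_refl S] by linarith
    qed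
    then show ?thesis using dense_ge[of 0 "\<bar>(\<integral>x. F x \<partial>M) - (\<integral>x. F x \<partial>N)\<bar>"] by fastforce
  qed
  have pM: "prob_space M" and pN: "prob_space N" using M(2) N(2) by (auto simp: chain_def)
  interpret M: prob_space M by fact
  interpret N: prob_space N by fact
  show ?thesis
  proof (rule measure_eqI_PiM_infinite[where I = UNIV and M = "\<lambda>_. count_space G"])
    show "sets M = sets (PiM UNIV (\<lambda>_. count_space G))" "sets N = sets (PiM UNIV (\<lambda>_. count_space G))"
      using M(1) N(1) by (auto simp: path_space_def)
    show "finite_measure M" by (rule M.finite_measure_axioms)
    fix A :: "int \<Rightarrow> nat set" and J :: "int set"
    assume J: "finite J"
    let ?X = "prod_emb UNIV (\<lambda>_. count_space G) J (PiE J A)"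
    let ?F = "\<lambda>x. of_bool (\<forall>s\<in>J. x s \<in> A s) :: real"
    have X: "?X = {x \<in> space (path_space G). \<forall>s\<in>J. x s \<in> A s}"
      by (auto simp: prod_emb_def path_space_def space_PiM)
    have "measure Q ?X = (\<integral>x. ?F x \<partial>Q)" if Q: "sets Q = sets (path_space G)" "chain Q 0 0" for Q
    proof -
      have "(\<integral>x. ?F x \<partial>Q) = (\<integral>x. indicator ?X x \<partial>Q)"
        using sets_eq_imp_space_eq[OF Q(1)] unfolding X
        by (intro Bochner_Integration.integral_cong) (auto simp: indicator_def)
      also have "\<dots> = measure Q (?X \<inter> space Q)" by simp
      also have "?X \<inter> space Q = ?X" using sets_eq_imp_space_eq[OF Q(1)] unfolding X by auto
      finally show ?thesis ..
    qed
    from this[OF M] this[OF N] eq[OF prodf_cylinder[OF J, of A]]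
    show "emeasure M ?X = emeasure N ?X"
      by (simp add: M.emeasure_eq_measure N.emeasure_eq_measure)
  qed
qed

end

section \<open>Matrices and words\<close>

lemma pmf_expectation_infsum:
  fixes h :: "'a \<Rightarrow> real"
  assumes h: "\<And>x. \<bar>h x\<bar> \<le> C" and "\<And>x. x \<notin> A \<Longrightarrow> pmf p x = 0"
  shows "measure_pmf.expectation p h = infsum (\<lambda>x. pmf p x * h x) A"
proof -
  have "integrable p h" by (rule measure_pmf.integrable_const_bound[of _ C]) (use h in auto)
  then have "Infinite_Set_Sum.abs_summable_on (\<lambda>x. pmf p x * h x) UNIV"
    unfolding measure_pmf_eq_density Infinite_Set_Sum.abs_summable_on_def
    by (subst (asm) integrable_density) auto
  from infsetsum_infsum[OF this]
  have "infsum (\<lambda>x. pmf p x * h x) UNIV = (\<integral>x. pmf p x * h x \<partial>count_space UNIV)"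
    unfolding infsetsum_def by simp
  also have "\<dots> = measure_pmf.expectation p h"
    unfolding measure_pmf_eq_density by (subst integral_density) auto
  finally have "measure_pmf.expectation p h = infsum (\<lambda>x. pmf p x * h x) UNIV" ..
  also have "\<dots> = infsum (\<lambda>x. pmf p x * h x) A"
    by (rule infsum_cong_neutral) (use assms(2) in auto)
  finally show ?thesis .
qed

text \<open>The accumulated matrix is generalised to a kernel \<open>R\<close> because
  \<open>foldl\<close> multiplies each new matrix from the left: the last letter is the first
  transition made from \<open>i\<close>, as in \<open>word_pmf\<close>.\<close>

lemma foldl_matmul_pmf:
  fixes P :: "nat \<Rightarrow> nat \<Rightarrow> nat \<Rightarrow> real"
  assumes Q: "\<And>k i g. k \<in> A \<Longrightarrow> i \<in> G \<Longrightarrow> pmf (Q k i) g = (if g \<in> G then P k i g else 0)"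
    and "set w \<subseteq> A" "i \<in> G" "\<And>l. l \<in> G \<Longrightarrow> M l j = pmf (R l) j"
  shows "foldl (\<lambda>M b. matmul G (P b) M) M w i j = pmf (bind_pmf (word_pmf Q w i) R) j"
  using assms(2-)
proof (induction w arbitrary: M R)
  case Nil
  then show ?case by (simp add: bind_return_pmf)
next
  case (Cons b w)
  have "matmul G (P b) M l j = pmf (bind_pmf (Q b l) R) j" if l: "l \<in> G" for l
  proof -
    have "matmul G (P b) M l j = infsum (\<lambda>g. pmf (Q b l) g * pmf (R g) j) G"
      unfolding matmul_def using Cons.prems Q l by (intro infsum_cong) auto
    also have "\<dots> = measure_pmf.expectation (Q b l) (\<lambda>g. pmf (R g) j)"
      using Cons.prems Q l by (intro pmf_expectation_infsum[of _ 1, symmetric]) (auto simp: pmf_le_1)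
    finally show ?thesis by (simp add: pmf_bind)
  qed
  then have "foldl (\<lambda>M b. matmul G (P b) M) (matmul G (P b) M) w i j
      = pmf (bind_pmf (word_pmf Q w i) (\<lambda>l. bind_pmf (Q b l) R)) j"
    using Cons.prems by (intro Cons.IH) auto
  then show ?case by (simp add: bind_assoc_pmf)
qed

lemma word_mat_pmf:
  fixes P :: "nat \<Rightarrow> nat \<Rightarrow> nat \<Rightarrow> real"
  assumes Q: "\<And>k i g. k \<in> A \<Longrightarrow> i \<in> G \<Longrightarrow> pmf (Q k i) g = (if g \<in> G then P k i g else 0)"
    and "set w \<subseteq> A" "w \<noteq> []" "i \<in> G" "j \<in> G"
  shows "word_mat G P w i j = pmf (word_pmf Q w i) j"
proof (cases w)
  case (Cons a w')
  then show ?thesis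
    using assms foldl_matmul_pmf[of A G Q P w' i "P a" j "Q a"] by simp
qed (use assms in simp)

text \<open>Serves to transfer the bound of Hypothesis D from state 1 to states outside
  \<open>G\<close>, whose rows copy row 1.\<close>

lemma word_pmf_initial:
  assumes "w \<noteq> []" "\<And>k. Q k i = Q k i'"
  shows "word_pmf Q w i = word_pmf Q w i'"
  using assms(1)
proof (induction w rule: list_nonempty_induct)
  case (single a)
  then show ?case by (simp add: bind_return_pmf assms(2))
qed simp

text \<open>The depth bounds every letter and, letters being positive, also the length.\<close>

lemma finite_words:
  assumes "0 \<notin> A"
  shows "finite {w. set w \<subseteq> A \<and> sum_list w = (n :: nat)}"
proof (rule finite_subset)
  show "{w. set w \<subseteq> A \<and> sum_list w = n} \<subseteq> {w. set w \<subseteq> {..n} \<and> length w \<le> n}"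
  proof (rule subsetI)
    fix w assume "w \<in> {w. set w \<subseteq> A \<and> sum_list w = n}"
    then have w: "set w \<subseteq> A" "sum_list w = n" by auto
    then have "set w \<subseteq> {..n}" using member_le_sum_list by auto
    moreover have "length w \<le> sum_list w" using w(1)
    proof (induction w)
      case (Cons a w)
      then have "a \<noteq> 0" using assms by (metis list.set_intros(1) subsetD)
      then show ?case using Cons by simp
    qed simp
    ultimately show "w \<in> {w. set w \<subseteq> {..n} \<and> length w \<le> n}" using w by simp
  qed
  show "finite {w. set w \<subseteq> {..n} \<and> length w \<le> n}"
    by (rule finite_lists_length_le) simp
qed

theorem mainTheorem14:
  fixes G :: "nat set" and A :: "nat set" and \<theta> :: "nat \<Rightarrow> real"
    and P :: "nat \<Rightarrow> nat \<Rightarrow> nat \<Rightarrow> real"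
  assumes G: "G = {1..} \<or> (\<exists>N\<ge>1. G = {1..N})"
    and A: "A \<subseteq> {1..}"
    and theta_pos: "\<forall>k\<in>A. \<theta> k > 0"
    and theta_prob: "(\<theta> has_sum 1) A"
    and P_stoch: "\<forall>k\<in>A. stochastic_on G (P k)"
    and hypD: "\<exists>n0 b \<epsilon>. n0 \<ge> (1::nat) \<and> (\<epsilon>::real) > 0 \<and>
                 (\<forall>i\<in>G. b i \<noteq> [] \<and> set (b i) \<subseteq> A \<and> depth (b i) = n0 \<and>
                         word_mat G P (b i) i 1 \<ge> \<epsilon>)"
  shows "\<exists>!M. compatible G (imitation_kernel A \<theta> P) M"
proof -
  have G1: "1 \<in> G" using G by auto
  have A0: "0 \<notin> A" using A by auto
  obtain \<Theta> where \<Theta>: "\<And>k. pmf \<Theta> k = (if k \<in> A then \<theta> k else 0)"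
    using pmf_exists[OF theta_prob] theta_pos by (metis less_imp_le)
  have set_\<Theta>: "set_pmf \<Theta> = A" using theta_pos by (auto simp: set_pmf_iff \<Theta> order_less_le split: if_splits)
  have "\<exists>q. \<forall>g. pmf q g = (if g \<in> G then P k i g else 0)" if "k \<in> A" "i \<in> G" for k i
    using P_stoch that pmf_exists[of "P k i" G] unfolding stochastic_on_def by metis
  then obtain Q0 where Q0: "\<And>k i g. k \<in> A \<Longrightarrow> i \<in> G \<Longrightarrow> pmf (Q0 k i) g = (if g \<in> G then P k i g else 0)"
    by metis
  \<comment> \<open>Rows outside \<open>G\<close> copy row 1, so that Hypothesis D holds for every \<open>i\<close>.\<close>
  define Q where "Q k i = (if k \<in> A then Q0 k (if i \<in> G then i else 1) else return_pmf 1)" for k i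
  have Q: "pmf (Q k i) g = (if g \<in> G then P k i g else 0)" if "k \<in> A" "i \<in> G" for k i g
    using that by (simp add: Q_def Q0)
  have supp: "set_pmf (Q k i) \<subseteq> G" for k i
    using G1 by (auto simp: Q_def set_pmf_iff Q0 split: if_splits)
  obtain n0 b \<epsilon> where n0: "1 \<le> n0" and \<epsilon>: "0 < \<epsilon>" and b: "\<And>i. i \<in> G \<Longrightarrow> b i \<noteq> []"
    "\<And>i. i \<in> G \<Longrightarrow> set (b i) \<subseteq> A" "\<And>i. i \<in> G \<Longrightarrow> sum_list (b i) = n0"
    "\<And>i. i \<in> G \<Longrightarrow> \<epsilon> \<le> word_mat G P (b i) i 1"
    using hypD unfolding depth_def by metis
  \<comment> \<open>Although \<open>G\<close> may be infinite, fixed depth and positive letters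
    leave only finitely many distinct words.\<close>
  interpret doeblin \<Theta> Q "b ` G" n0 \<epsilon>
  proof
    show "0 \<notin> set_pmf \<Theta>" using A0 set_\<Theta> by simp
    show "finite (b ` G)"
      by (rule finite_subset[OF _ finite_words[OF A0, of n0]]) (use b in auto)
    show "set w \<subseteq> set_pmf \<Theta>" if "w \<in> b ` G" for w using that b set_\<Theta> by auto
    show "sum_list w = n0" if "w \<in> b ` G" for w using that b by auto
    show "\<exists>w\<in>b ` G. \<epsilon> \<le> pmf (word_pmf Q w i) 1" for i
    proof -
      define i' where "i' = (if i \<in> G then i else 1)"
      have i': "i' \<in> G" using G1 by (simp add: i'_def)
      have "word_pmf Q (b i') i = word_pmf Q (b i') i'"
        by (rule word_pmf_initial[OF b(1)[OF i']]) (simp add: Q_def i'_def)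
      moreover have "\<epsilon> \<le> pmf (word_pmf Q (b i') i') 1"
        using b(4)[OF i'] word_mat_pmf[of A G Q P, OF Q b(2)[OF i'] b(1)[OF i'] i' G1] by simp
      ultimately show ?thesis using i' by (intro bexI[of _ "b i'"]) auto
    qed
  qed (use n0 \<epsilon> in auto)
  have kernel: "imitation_kernel A \<theta> P g w = (\<integral>k. pmf (Q k (w k)) g \<partial>\<Theta>)" if g: "g \<in> G" and w: "\<And>k. w k \<in> G" for g w
  proof -
    have "(\<integral>k. pmf (Q k (w k)) g \<partial>\<Theta>) = infsum (\<lambda>k. pmf \<Theta> k * pmf (Q k (w k)) g) A"
      by (rule pmf_expectation_infsum[of _ 1]) (auto simp: pmf_le_1 \<Theta>)
    also have "\<dots> = imitation_kernel A \<theta> P g w"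
      unfolding imitation_kernel_def by (rule infsum_cong) (use g w in \<open>simp add: \<Theta> Q\<close>)
    finally show ?thesis ..
  qed
  have compatible_iff: "compatible G (imitation_kernel A \<theta> P) M \<longleftrightarrow>
      sets M = sets (path_space G) \<and> (\<forall>s t. chain M s t)" for M
    by (rule compatible_iff_chain[OF _ supp]) (rule kernel)
  obtain M where "sets M = sets (path_space G)" "\<And>s t. chain M s t"
    using chain_exists[OF supp G1] by blast
  then show ?thesis
    unfolding compatible_iff by (intro ex1I[of _ M]) (auto intro: chain_unique)
qed

end
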